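(* Let $(\Sigma,\tau)$ be a subshift without isolated periodic points. Suppose that the complexity $\rho$ of $\Sigma$ satisfies $$\lim_{n\to\infty}\left(\frac{\log n}{n}\right)^2\rho(n)=0.$$ Then for every finitely supported symmetric probability measure $\mu$ on the topological full group $[[\tau]]$ the random walk entropy vanishes: $h(\mu)=0$. More precisely, for every such $\mu$ there exists a constant $C>0$ such that for every $n\geq 2$ $$H(\mu^{*n})\leq C\,\rho\big(\lceil C\sqrt{n\log n}\,\rceil\big)\log n.$$
   Context: Let $\mathcal{A}$ be a finite alphabet and give $\mathcal{A}^{\mathbb{Z}}$ the product topology. The shift $\tau$ acts by $(\tau x)_i=x_{i+1}$. A subshift $(\Sigma,\tau)$ is a closed shift-invariant subset $\Sigma\subset\mathcal{A}^{\mathbb{Z}}$ with the restriction of $\tau$. "Without isolated periodic points" means that no $\tau$-periodic point of $\Sigma$ is isolated in $\Sigma$. The complexity $\rho(n)$ is the number of words of length $n$ over $\mathcal{A}$ that appear as sub-words of sequences in $\Sigma$. The topological full group $[[\tau]]$ is the group of homeomorphisms $g$ of $\Sigma$ such that there is a continuous function $k_g:\Sigma\to\mathbb{Z}$ with $g(x)=\tau^{k_g(x)}(x)$ for all $x\in\Sigma$. The measure $\mu$ is symmetric if $\mu(g)=\mu(g^{-1})$; its support need not generate $[[\tau]]$. For a probability measure $\mu$ on a countable group $G$, $H(\mu)=-\sum_{g\in G}\mu(g)\log\mu(g)$, $\mu^{*n}$ is the $n$-th convolution power, and the random walk entropy is $h(\mu)=\lim_{n\to\infty}\frac1n H(\mu^{*n})$.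 *)

theory Defs
  imports "HOL-Analysis.Analysis" "HOL-Probability.Probability" "HOL-Algebra.Bij"
begin

section \<open>Subshifts\<close>

definition full_shift_topology :: "'a set \<Rightarrow> (int \<Rightarrow> 'a) topology" where
  "full_shift_topology A = product_topology (\<lambda>_. discrete_topology A) UNIV"

definition shift :: "(int \<Rightarrow> 'a) \<Rightarrow> (int \<Rightarrow> 'a)" where
  "shift x = (\<lambda>i. x (i + 1))"

text \<open>The power of the shift with an arbitrary integer exponent; the three lemmas
  below identify it with the iterates of the shift and of its inverse.\<close>

definition shift_pow :: "int \<Rightarrow> (int \<Rightarrow> 'a) \<Rightarrow> (int \<Rightarrow> 'a)" where
  "shift_pow k x = (\<lambda>i. x (i + k))"

lemma bij_shift: "bij shift"
  by (rule o_bij[where g = "shift_pow (- 1)"]) (auto simp: shift_def shift_pow_def fun_eq_iff)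

lemma shift_pow_of_nat: "shift_pow (int n) = shift ^^ n"
  by (induction n) (auto simp: shift_def shift_pow_def fun_eq_iff algebra_simps)

lemma shift_pow_minus_of_nat: "shift_pow (- int n) = (inv_into UNIV shift) ^^ n"
proof -
  have inv: "inv_into UNIV shift = (shift_pow (- 1) :: (int \<Rightarrow> 'a) \<Rightarrow> _)"
    by (rule inv_unique_comp) (auto simp: shift_def shift_pow_def fun_eq_iff)
  show ?thesis
    unfolding inv
    by (induction n) (auto simp: shift_pow_def fun_eq_iff algebra_simps)
qed

lemma shift_pow_shift_pow: "shift_pow j (shift_pow k x) = shift_pow (j + k) x"
  by (simp add: shift_pow_def algebra_simps)

text \<open>Since the shift acts as a homeomorphism of the subshift, invariance is an equality.\<close>

definition subshift :: "'a set \<Rightarrow> (int \<Rightarrow> 'a) set \<Rightarrow> bool" where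
  "subshift A \<Sigma> \<longleftrightarrow> finite A \<and> closedin (full_shift_topology A) \<Sigma> \<and> shift ` \<Sigma> = \<Sigma>"

definition subshift_topology :: "'a set \<Rightarrow> (int \<Rightarrow> 'a) set \<Rightarrow> (int \<Rightarrow> 'a) topology" where
  "subshift_topology A \<Sigma> = subtopology (full_shift_topology A) \<Sigma>"

definition periodic_point :: "(int \<Rightarrow> 'a) \<Rightarrow> bool" where
  "periodic_point x \<longleftrightarrow> (\<exists>p>0. (shift ^^ p) x = x)"

definition no_isolated_periodic_points :: "'a set \<Rightarrow> (int \<Rightarrow> 'a) set \<Rightarrow> bool" where
  "no_isolated_periodic_points A \<Sigma> \<longleftrightarrow>
     (\<forall>x\<in>\<Sigma>. periodic_point x \<longrightarrow> \<not> openin (subshift_topology A \<Sigma>) {x})"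

definition subwords :: "(int \<Rightarrow> 'a) set \<Rightarrow> nat \<Rightarrow> 'a list set" where
  "subwords \<Sigma> n = {w. length w = n \<and> (\<exists>x\<in>\<Sigma>. \<exists>i. \<forall>j<n. w ! j = x (i + int j))}"

definition complexity :: "(int \<Rightarrow> 'a) set \<Rightarrow> nat \<Rightarrow> nat" where
  "complexity \<Sigma> n = card (subwords \<Sigma> n)"

lemma subshift_imp_range: "subshift A \<Sigma> \<Longrightarrow> x \<in> \<Sigma> \<Longrightarrow> x i \<in> A"
  using closedin_subset[of "full_shift_topology A" \<Sigma>]
  by (auto simp: subshift_def full_shift_topology_def)

lemma finite_subwords:
  assumes "subshift A \<Sigma>"
  shows "finite (subwords \<Sigma> n)"
proof (rule finite_subset)
  show "subwords \<Sigma> n \<subseteq> {w. set w \<subseteq> A \<and> length w = n}"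
    using subshift_imp_range[OF assms] by (force simp: subwords_def set_conv_nth)
  show "finite {w. set w \<subseteq> A \<and> length w = n}"
    using assms by (intro finite_lists_length_eq) (simp add: subshift_def)
qed

lemma topspace_subshift_topology: "subshift A \<Sigma> \<Longrightarrow> topspace (subshift_topology A \<Sigma>) = \<Sigma>"
  unfolding subshift_def subshift_topology_def
  by (meson closedin_subset topspace_subtopology_subset)


section \<open>The topological full group\<close>

text \<open>As in \<^const>\<open>BijGroup\<close>, a self-map of the subshift is represented by the function that
  is \<^const>\<open>undefined\<close> off the subshift, so that each homeomorphism is counted once.\<close>

definition topological_full_group ::
    "'a set \<Rightarrow> (int \<Rightarrow> 'a) set \<Rightarrow> ((int \<Rightarrow> 'a) \<Rightarrow> (int \<Rightarrow> 'a)) monoid" where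
  "topological_full_group A \<Sigma> = (BijGroup \<Sigma>)
     \<lparr>carrier := {g \<in> Bij \<Sigma>.
        homeomorphic_map (subshift_topology A \<Sigma>) (subshift_topology A \<Sigma>) g \<and>
        (\<exists>k. continuous_map (subshift_topology A \<Sigma>) (discrete_topology UNIV) k \<and>
             (\<forall>x\<in>\<Sigma>. g x = shift_pow (k x) x))}\<rparr>"

lemma continuous_map_discrete_combine:
  assumes "continuous_map X (discrete_topology UNIV) f" "continuous_map X (discrete_topology UNIV) g"
  shows "continuous_map X (discrete_topology UNIV) (\<lambda>x. h (f x) (g x))"
proof -
  have "openin X {x \<in> topspace X. h (f x) (g x) \<in> U}" for U
  proof -
    have "{x \<in> topspace X. h (f x) (g x) \<in> U} =
        (\<Union>(a, b) \<in> {(a, b). h a b \<in> U}. {x \<in> topspace X. f x \<in> {a}} \<inter> {x \<in> topspace X. g x \<in> {b}})"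
      by auto
    also have "openin X \<dots>"
    proof (rule openin_Union, clarify)
      fix a b
      have "openin X {x \<in> topspace X. f x \<in> {a}}" "openin X {x \<in> topspace X. g x \<in> {b}}"
        by (rule openin_continuous_map_preimage[OF assms(1)], simp)
          (rule openin_continuous_map_preimage[OF assms(2)], simp)
      then show "openin X ({x \<in> topspace X. f x \<in> {a}} \<inter> {x \<in> topspace X. g x \<in> {b}})"
        by (rule openin_Int)
    qed
    finally show ?thesis .
  qed
  then show ?thesis
    by (auto simp: continuous_map_def)
qed

theorem group_topological_full_group:
  assumes "subshift A \<Sigma>"
  shows "group (topological_full_group A \<Sigma>)"
proof -
  interpret B: group "BijGroup \<Sigma>" by (rule group_BijGroup)
  define T where "T = subshift_topology A \<Sigma>"
  define K where "K = {g \<in> Bij \<Sigma>. homeomorphic_map T T g \<and>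
        (\<exists>k. continuous_map T (discrete_topology UNIV) k \<and> (\<forall>x\<in>\<Sigma>. g x = shift_pow (k x) x))}"
  have top: "topspace T = \<Sigma>"
    using assms by (simp add: T_def topspace_subshift_topology)
  have "subgroup K (BijGroup \<Sigma>)"
  proof (rule B.subgroupI)
    show "K \<subseteq> carrier (BijGroup \<Sigma>)"
      by (auto simp: K_def BijGroup_def)
    have "(\<lambda>x\<in>\<Sigma>. x) \<in> K"
    proof -
      have "homeomorphic_map T T (\<lambda>x\<in>\<Sigma>. x)"
        by (rule homeomorphic_map_eq[of T T id]) (auto simp: top)
      moreover have "continuous_map T (discrete_topology UNIV) (\<lambda>_. 0::int)"
        by simp
      ultimately show ?thesis
        by (auto simp: K_def id_Bij shift_pow_def intro!: exI[of _ "\<lambda>_. 0"])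
    qed
    then show "K \<noteq> {}" by blast
  next
    fix g assume "g \<in> K"
    then obtain k where g: "g \<in> Bij \<Sigma>" "homeomorphic_map T T g"
        "continuous_map T (discrete_topology UNIV) k" "\<And>x. x \<in> \<Sigma> \<Longrightarrow> g x = shift_pow (k x) x"
      by (auto simp: K_def)
    define g' where "g' = (\<lambda>x\<in>\<Sigma>. inv_into \<Sigma> g x)"
    have gg': "g (g' x) = x" "g' x \<in> \<Sigma>" if "x \<in> \<Sigma>" for x
      using that g(1) by (auto simp: g'_def Bij_def bij_betw_def f_inv_into_f inv_into_into)
    have g'g: "g' (g x) = x" "g x \<in> \<Sigma>" if "x \<in> \<Sigma>" for x
      using that g(1) by (auto simp: g'_def Bij_def bij_betw_def inv_into_f_f)
    have g'B: "g' \<in> Bij \<Sigma>"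
      using g(1) unfolding g'_def by (rule restrict_inv_into_Bij)
    obtain h where h: "homeomorphic_maps T T g h"
      using g(2) homeomorphic_map_maps by blast
    then have hg: "h x = g' x" if "x \<in> topspace T" for x
      using gg' g'g that unfolding homeomorphic_maps_def top by metis
    have hom: "homeomorphic_map T T g'"
      using homeomorphic_map_eq[of T T h g'] h hg by (simp add: homeomorphic_maps_map)
    have "continuous_map T (discrete_topology UNIV) (k \<circ> g')"
      using hom g(3) by (blast intro: continuous_map_compose homeomorphic_imp_continuous_map)
    then have "continuous_map T (discrete_topology UNIV) (\<lambda>x. - k (g' x))"
      using continuous_map_discrete_combine[of T _ _ "\<lambda>a b. - a"] by (auto simp: o_def)
    moreover have "g' x = shift_pow (- k (g' x)) x" if "x \<in> \<Sigma>" for x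
    proof -
      have "shift_pow (- k (g' x)) x = shift_pow (- k (g' x)) (shift_pow (k (g' x)) (g' x))"
        using gg'[OF that] g(4)[of "g' x"] by simp
      then show ?thesis by (simp add: shift_pow_def)
    qed
    ultimately have "g' \<in> K"
      using g'B hom by (auto simp: K_def intro!: exI[of _ "\<lambda>x. - k (g' x)"])
    then show "inv\<^bsub>BijGroup \<Sigma>\<^esub> g \<in> K"
      using inv_BijGroup[OF g(1)] by (simp add: g'_def)
  next
    fix g h assume "g \<in> K" "h \<in> K"
    then obtain k l where g: "g \<in> Bij \<Sigma>" "homeomorphic_map T T g"
        "continuous_map T (discrete_topology UNIV) k" "\<And>x. x \<in> \<Sigma> \<Longrightarrow> g x = shift_pow (k x) x"
      and h: "h \<in> Bij \<Sigma>" "homeomorphic_map T T h"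
        "continuous_map T (discrete_topology UNIV) l" "\<And>x. x \<in> \<Sigma> \<Longrightarrow> h x = shift_pow (l x) x"
      unfolding K_def by blast
    have hom: "homeomorphic_map T T (compose \<Sigma> g h)"
      by (rule homeomorphic_map_eq[OF homeomorphic_map_compose[OF h(2) g(2)]])
        (auto simp: top compose_def)
    have "continuous_map T (discrete_topology UNIV) (k \<circ> h)"
      using h(2) g(3) by (blast intro: continuous_map_compose homeomorphic_imp_continuous_map)
    then have "continuous_map T (discrete_topology UNIV) (\<lambda>x. k (h x) + l x)"
      using continuous_map_discrete_combine[of T _ l "(+)"] h(3) by (auto simp: o_def)
    moreover have "compose \<Sigma> g h x = shift_pow (k (h x) + l x) x" if "x \<in> \<Sigma>" for x
    proof -
      have "h x \<in> \<Sigma>" using that h(1) by (auto simp: Bij_def bij_betw_def)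
      then show ?thesis
        using that g(4)[of "h x"] h(4)[of x] by (simp add: compose_def shift_pow_shift_pow)
    qed
    ultimately have "compose \<Sigma> g h \<in> K"
      using hom compose_Bij[OF g(1) h(1)]
      by (auto simp: K_def intro!: exI[of _ "\<lambda>x. k (h x) + l x"])
    then show "g \<otimes>\<^bsub>BijGroup \<Sigma>\<^esub> h \<in> K"
      using g(1) h(1) by (simp add: BijGroup_def)
  qed
  then show ?thesis
    using B.subgroup_imp_group by (simp add: topological_full_group_def K_def T_def)
qed


section \<open>Random walks on groups\<close>

text \<open>A probability measure on a group \<open>G\<close> is a \<^typ>\<open>'g pmf\<close> whose support lies in
  \<^term>\<open>carrier G\<close>.\<close>

definition symmetric_pmf :: "('g, 'm) monoid_scheme \<Rightarrow> 'g pmf \<Rightarrow> bool" where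
  "symmetric_pmf G \<mu> \<longleftrightarrow> (\<forall>g\<in>carrier G. pmf \<mu> g = pmf \<mu> (inv\<^bsub>G\<^esub> g))"

definition convolution :: "('g, 'm) monoid_scheme \<Rightarrow> 'g pmf \<Rightarrow> 'g pmf \<Rightarrow> 'g pmf" where
  "convolution G \<mu> \<nu> = map_pmf (\<lambda>(g, h). g \<otimes>\<^bsub>G\<^esub> h) (pair_pmf \<mu> \<nu>)"

primrec convolution_power :: "('g, 'm) monoid_scheme \<Rightarrow> 'g pmf \<Rightarrow> nat \<Rightarrow> 'g pmf" where
  "convolution_power G \<mu> 0 = return_pmf \<one>\<^bsub>G\<^esub>"
| "convolution_power G \<mu> (Suc n) = convolution G (convolution_power G \<mu> n) \<mu>"

text \<open>The summand vanishes off the support because \<open>0 * ln 0 = 0\<close>. The value is meaningful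
  for measures of finite entropy, in particular for all finitely supported ones; a divergent
  sum is assigned the value \<open>0\<close>.\<close>

definition shannon_entropy :: "'g pmf \<Rightarrow> real" where
  "shannon_entropy \<mu> = - (\<Sum>\<^sub>\<infinity>g. pmf \<mu> g * ln (pmf \<mu> g))"

definition random_walk_entropy :: "('g, 'm) monoid_scheme \<Rightarrow> 'g pmf \<Rightarrow> real" where
  "random_walk_entropy G \<mu> = lim (\<lambda>n. shannon_entropy (convolution_power G \<mu> n) / real n)"

lemma finite_set_pmf_convolution_power:
  "finite (set_pmf \<mu>) \<Longrightarrow> finite (set_pmf (convolution_power G \<mu> n))"
  by (induction n) (auto simp: convolution_def)

lemma shannon_entropy_finite:
  assumes "finite (set_pmf \<mu>)"
  shows "shannon_entropy \<mu> = - (\<Sum>g\<in>set_pmf \<mu>. pmf \<mu> g * ln (pmf \<mu> g))"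
proof -
  have "(\<Sum>\<^sub>\<infinity>g. pmf \<mu> g * ln (pmf \<mu> g)) = (\<Sum>\<^sub>\<infinity>g\<in>set_pmf \<mu>. pmf \<mu> g * ln (pmf \<mu> g))"
    by (rule infsum_cong_neutral) (auto simp: set_pmf_iff)
  then show ?thesis
    using assms by (simp add: shannon_entropy_def)
qed

end

theory Submission
  imports Defs "HOL-Real_Asymp.Real_Asymp"
begin

text \<open>
  An element \<open>g\<close> of the topological full group displaces every point \<open>x\<close> along its orbit by an
  integer \<open>k x\<close>. The idea is that after \<open>n\<close> random steps all these displacements have, with high
  probability, size \<open>O(sqrt (n log n))\<close>, so that the product is described by a table with one small
  integer for each word of length \<open>O(sqrt (n log n))\<close> of the subshift. There are
  \<open>exp (O(\<rho>(C sqrt (n log n)) log n))\<close> such tables, and the logarithm of their number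
  is the claimed entropy bound.

  The cocycle: the displacements of \<open>s\<close> and of \<open>s\<^sup>-\<^sup>1\<close> cancel along the orbit
  (\<open>displacement_of_inverse\<close>). Where they did not, every point would be periodic with one fixed
  period, on an open set; such a set is finite, so it would consist of isolated periodic points
  (\<open>displacement_fixing_all_points\<close>). Hence for each fixed \<open>x\<close> the displacement of \<open>x\<close> performs a
  Markov chain on the integers which is symmetric, because \<open>\<mu>\<close> is (\<open>jump_sym\<close>), and whose jumps are
  bounded, because the subshift is compact. The chain depends on \<open>x\<close> and is not homogeneous in space.

  The diffusive bound: symmetry alone gives the Carne-Varopoulos inequality
  (\<open>Carne_Varopoulos\<close>), a Gaussian bound on transition probabilities. A displacement beyond
  \<open>4 R sqrt (n log n)\<close>, where \<open>R\<close> bounds the jumps, therefore has a probability below any power of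
  \<open>n\<close> that is needed here.

  The union bound: the whole walk of \<open>x\<close> up to time \<open>n\<close> reads only a window of \<open>x\<close> of length
  \<open>O(n)\<close>, and the hypothesis on \<open>\<rho>\<close> makes the number of such windows \<open>O(n\<^sup>2)\<close>. So up to an event of
  probability \<open>O(1/n)\<close> all walks, from all points and at all times, stay confined
  (\<open>prob_not_confined\<close>). All times matter: only when the intermediate positions are confined too
  does the final displacement depend on a short window around \<open>x\<close>
  (\<open>disp_local\<close>, \<open>card_confined_elements\<close>). On the exceptional event there are at
  most \<open>exp (O(n))\<close> products, which costs \<open>O(1)\<close> of entropy (\<open>shannon_entropy_le_split\<close>).

  Finally, with \<open>m\<close> of order \<open>sqrt (n log n)\<close>, the quantity \<open>\<rho>(m) log n / n\<close> is of order
  \<open>(log m / m)\<^sup>2 \<rho>(m)\<close>, which tends to zero by hypothesis (\<open>slow_bound_imp_sublinear\<close>).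
\<close>

section \<open>The Carne-Varopoulos bound\<close>

text \<open>\<open>cosh\<close> is the moment generating function of a fair sign; Hoeffding's estimate for a fair coin
  with values \<open>0\<close> and \<open>2 x\<close> gives the bound after centring.\<close>

lemma cosh_le_exp: "cosh (x::real) \<le> exp (x\<^sup>2 / 2)"
proof -
  have *: "cosh x \<le> exp (x\<^sup>2 / 2)" if "x \<ge> 0" for x :: real
  proof -
    have "1 + 1 / 2 * (exp (2 * x) - 1) = exp x * cosh x"
      by (simp add: cosh_field_def field_simps flip: exp_add)
    moreover have "ln (exp x * cosh x) = x + ln (cosh x)"
      by (subst ln_mult) (auto simp: cosh_real_pos)
    ultimately have "ln (cosh x) \<le> x\<^sup>2 / 2"
      using Hoeffdings_lemma_aux[of "2 * x" "1 / 2"] that by (simp add: power2_eq_square)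
    then show ?thesis by (metis exp_le_cancel_iff exp_ln cosh_real_pos)
  qed
  show ?thesis using *[of x] *[of "-x"] by (cases "x \<ge> 0") auto
qed

locale substochastic_kernel =
  fixes V :: "'v set" and P :: "'v \<Rightarrow> 'v \<Rightarrow> real"
  assumes finite_V: "finite V"
    and nonneg: "0 \<le> P u v"
    and sym: "P u v = P v u"
    and row_le: "u \<in> V \<Longrightarrow> (\<Sum>v\<in>V. P u v) \<le> 1"
begin

definition Op :: "('v \<Rightarrow> real) \<Rightarrow> 'v \<Rightarrow> real" where
  "Op f = (\<lambda>u. \<Sum>v\<in>V. P u v * f v)"

definition ip :: "('v \<Rightarrow> real) \<Rightarrow> ('v \<Rightarrow> real) \<Rightarrow> real" where
  "ip f g = (\<Sum>v\<in>V. f v * g v)"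

lemma ip_sym: "ip f g = ip g f"
  by (simp add: ip_def mult_ac)

lemma ip_linear:
  "ip (\<lambda>v. f v + g v) h = ip f h + ip g h" "ip h (\<lambda>v. f v + g v) = ip h f + ip h g"
  "ip (\<lambda>v. f v - g v) h = ip f h - ip g h" "ip h (\<lambda>v. f v - g v) = ip h f - ip h g"
  by (simp_all add: ip_def algebra_simps sum.distrib sum_subtractf)

lemma Op_add: "Op (\<lambda>v. f v + g v) = (\<lambda>v. Op f v + Op g v)"
  and Op_diff: "Op (\<lambda>v. f v - g v) = (\<lambda>v. Op f v - Op g v)"
  by (simp_all add: Op_def algebra_simps sum.distrib sum_subtractf)

lemma Op_scale: "Op (\<lambda>v. c * f v) = (\<lambda>v. c * Op f v)"
  by (simp add: Op_def sum_distrib_left mult_ac)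

lemma Op_selfadjoint: "ip (Op f) g = ip f (Op g)"
proof -
  have "ip (Op f) g = (\<Sum>u\<in>V. \<Sum>v\<in>V. P u v * f v * g u)"
    by (simp add: ip_def Op_def sum_distrib_right)
  also have "\<dots> = (\<Sum>v\<in>V. \<Sum>u\<in>V. P u v * f v * g u)"
    by (rule sum.swap)
  also have "\<dots> = ip f (Op g)"
    by (simp add: ip_def Op_def sum_distrib_left sym mult_ac)
  finally show ?thesis .
qed

text \<open>Cauchy-Schwarz with the weights \<open>P u v\<close>, whose row sums, and by symmetry column sums, are
  at most one.\<close>

lemma Op_contraction: "ip (Op f) (Op f) \<le> ip f f"
proof -
  have 1: "(Op f u)\<^sup>2 \<le> (\<Sum>v\<in>V. P u v * (f v)\<^sup>2)" if "u \<in> V" for u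
  proof -
    have "(Op f u)\<^sup>2 = (\<Sum>v\<in>V. sqrt (P u v) * (sqrt (P u v) * f v))\<^sup>2"
      by (simp add: Op_def nonneg flip: mult.assoc)
    also have "\<dots> \<le> (\<Sum>v\<in>V. (sqrt (P u v))\<^sup>2) * (\<Sum>v\<in>V. (sqrt (P u v) * f v)\<^sup>2)"
      by (rule Cauchy_Schwarz_ineq_sum)
    also have "\<dots> = (\<Sum>v\<in>V. P u v) * (\<Sum>v\<in>V. P u v * (f v)\<^sup>2)"
      by (simp add: nonneg power_mult_distrib)
    also have "\<dots> \<le> 1 * (\<Sum>v\<in>V. P u v * (f v)\<^sup>2)"
      by (intro mult_right_mono row_le that sum_nonneg mult_nonneg_nonneg nonneg) auto
    finally show ?thesis by simp
  qed
  have "ip (Op f) (Op f) \<le> (\<Sum>u\<in>V. \<Sum>v\<in>V. P u v * (f v)\<^sup>2)"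
    unfolding ip_def power2_eq_square[symmetric] by (intro sum_mono 1)
  also have "\<dots> = (\<Sum>v\<in>V. \<Sum>u\<in>V. P u v * (f v)\<^sup>2)"
    by (rule sum.swap)
  also have "\<dots> = (\<Sum>v\<in>V. (\<Sum>u\<in>V. P v u) * (f v)\<^sup>2)"
    by (simp add: sum_distrib_right sym)
  also have "\<dots> \<le> (\<Sum>v\<in>V. 1 * (f v)\<^sup>2)"
    by (intro sum_mono mult_right_mono row_le) auto
  finally show ?thesis by (simp add: ip_def power2_eq_square)
qed

text \<open>
  With \<open>T\<close> and \<open>U\<close> the Chebyshev polynomials of the first and second kind, \<open>cheb f k\<close> is
  \<open>T\<^sub>k(Op) f\<close> and \<open>cheb_companion f k\<close> is \<open>U\<^sub>k\<^sub>-\<^sub>1(Op) f\<close>. With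
  \<open>Op = cos \<theta>\<close> these are \<open>cos (k \<theta>)\<close> and \<open>sin (k \<theta>) / sin \<theta>\<close>, and the recursion is the
  addition theorem for the angle \<open>k \<theta> + \<theta>\<close>. Carrying both along allows \<open>T\<^sub>k(Op)\<close> to be bounded
  without diagonalising \<open>Op\<close>.
\<close>

fun cheb cheb_companion :: "('v \<Rightarrow> real) \<Rightarrow> nat \<Rightarrow> 'v \<Rightarrow> real" where
  "cheb f 0 = f"
| "cheb_companion f 0 = (\<lambda>v. 0)"
| "cheb f (Suc k) = (\<lambda>v. Op (cheb f k) v - cheb_companion f k v + Op (Op (cheb_companion f k)) v)"
| "cheb_companion f (Suc k) = (\<lambda>v. Op (cheb_companion f k) v + cheb f k v)"

text \<open>The quadratic form of \<open>cos\<^sup>2 + sin\<^sup>2\<close>: since \<open>cheb_companion\<close> lacks the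
  factor \<open>sin \<theta>\<close>, the second term is weighted with \<open>1 - Op\<^sup>2\<close>.\<close>

definition energy :: "('v \<Rightarrow> real) \<Rightarrow> ('v \<Rightarrow> real) \<Rightarrow> real" where
  "energy a b = ip a a + ip b b - ip (Op b) (Op b)"

text \<open>The recursion step is a rotation by \<open>\<theta>\<close>; expanding the squares, only
  self-adjointness of \<open>Op\<close> is used.\<close>

lemma energy_step:
  "energy (\<lambda>v. Op a v - b v + Op (Op b) v) (\<lambda>v. Op b v + a v) = energy a b"
proof -
  have 1: "ip (Op a) b = ip a (Op b)" "ip b (Op (Op b)) = ip (Op b) (Op b)"
    by (simp_all add: Op_selfadjoint)
  have 2: "ip b (Op a) = ip a (Op b)" "ip (Op (Op b)) b = ip (Op b) (Op b)"
    "ip (Op b) a = ip a (Op b)" "ip (Op (Op b)) (Op a) = ip (Op a) (Op (Op b))"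
    using 1 by (simp_all add: ip_sym)
  show ?thesis
    unfolding energy_def Op_add ip_linear using 1 2 by simp
qed

lemma energy_cheb: "energy (cheb f k) (cheb_companion f k) = ip f f"
proof (induction k)
  case 0
  show ?case by (simp add: energy_def ip_def Op_def)
next
  case (Suc k)
  then show ?case by (simp only: cheb.simps cheb_companion.simps energy_step)
qed

text \<open>The companion's share of the energy is nonnegative because \<open>Op\<close> is a contraction.\<close>

lemma cheb_norm_le: "ip (cheb f k) (cheb f k) \<le> ip f f"
  using energy_cheb[of f k] Op_contraction[of "cheb_companion f k"] by (simp add: energy_def)

lemma cheb_pointwise_le:
  assumes "u \<in> V" "v \<in> V"
  shows "\<bar>cheb (indicator {u}) k v\<bar> \<le> 1"
proof -
  let ?t = "cheb (indicator {u}) k"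
  have "ip (indicator {u}) (indicator {u}) = 1"
    using assms(1) finite_V by (simp add: ip_def indicator_def if_distrib cong: if_cong)
  moreover have "(?t v)\<^sup>2 \<le> ip ?t ?t"
    unfolding ip_def power2_eq_square[symmetric]
    using assms(2) finite_V by (intro member_le_sum) auto
  ultimately have "(?t v)\<^sup>2 \<le> 1"
    using cheb_norm_le[of "indicator {u}" k] by linarith
  then show ?thesis by (simp add: abs_le_square_iff[of _ 1, simplified])
qed

text \<open>The product formula \<open>2 cos \<theta> cos (k \<theta>) = cos ((k + 1) \<theta>) + cos ((k - 1) \<theta>)\<close>, with the
  case \<open>k = 0\<close> kept apart because the index is a natural number.\<close>

lemma Op_cheb_0: "Op (cheb f 0) = cheb f (Suc 0)"
  by (simp add: Op_def)

lemma Op_cheb_Suc: "Op (cheb f (Suc k)) = (\<lambda>v. (cheb f (Suc (Suc k)) v + cheb f k v) / 2)"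
  by (simp add: Op_add Op_diff fun_eq_iff field_simps)

text \<open>A polynomial of degree \<open>k\<close> in \<open>Op\<close> spreads a function by at most \<open>k\<close> in the
  coordinate \<open>\<phi>\<close>. The companion has degree \<open>k - 1\<close>; without this gain of one, the term
  \<open>Op\<^sup>2\<close> in the recursion would spread too far.\<close>

lemma cheb_propagation:
  assumes lip: "\<And>v w. P v w \<noteq> 0 \<Longrightarrow> \<bar>\<phi> v - \<phi> w\<bar> \<le> (1::real)"
    and f: "\<And>v. \<bar>\<phi> v - \<phi> u\<bar> > 0 \<Longrightarrow> f v = 0"
  shows "(\<forall>v. \<bar>\<phi> v - \<phi> u\<bar> > real k \<longrightarrow> cheb f k v = 0) \<and>
    (\<forall>v. \<bar>\<phi> v - \<phi> u\<bar> > real k - 1 \<longrightarrow> cheb_companion f k v = 0)"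
proof (induction k)
  case 0
  then show ?case using f by simp
next
  case (Suc k)
  have Op: "Op g v = 0" if "\<And>v. \<bar>\<phi> v - \<phi> u\<bar> > r \<Longrightarrow> g v = 0" "\<bar>\<phi> v - \<phi> u\<bar> > r + 1" for g r v
    unfolding Op_def
  proof (intro sum.neutral ballI)
    fix w
    show "P v w * g w = 0"
    proof (cases "P v w = 0")
      case False
      then have "\<bar>\<phi> w - \<phi> u\<bar> > r" using lip[of v w] that(2) by linarith
      then show ?thesis using that(1) by simp
    qed simp
  qed
  have T: "cheb f k v = 0" if "\<bar>\<phi> v - \<phi> u\<bar> > real k" for v using Suc that by blast
  have W: "cheb_companion f k v = 0" if "\<bar>\<phi> v - \<phi> u\<bar> > real k - 1" for v using Suc that by blast
  have OW: "Op (cheb_companion f k) v = 0" if "\<bar>\<phi> v - \<phi> u\<bar> > real k" for v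
    using Op[of "real k - 1" "cheb_companion f k" v] W that by simp
  have OOW: "Op (Op (cheb_companion f k)) v = 0" if "\<bar>\<phi> v - \<phi> u\<bar> > real k + 1" for v
    using Op[of "real k" "Op (cheb_companion f k)" v] OW that by simp
  have OT: "Op (cheb f k) v = 0" if "\<bar>\<phi> v - \<phi> u\<bar> > real k + 1" for v
    using Op[of "real k" "cheb f k" v] T that by simp
  show ?case
    using T W OW OOW OT by auto
qed

text \<open>
  Iterating the product formula, \<open>Op ^ n T\<^sub>k(Op)\<close> is the average of \<open>T\<^bsub>|k + S|\<^esub>(Op)\<close> over the
  position \<open>S\<close> of a simple random walk after \<open>n\<close> steps. Its value at \<open>v\<close> is thus at most the probability
  that \<open>|k + S|\<close> reaches the distance from \<open>u\<close> to \<open>v\<close>. The bound below is the Chernoff bound of that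
  probability, with the two-sided exponential moment \<open>2 cosh (l (k + S))\<close>; in this form it passes
  through the induction, since \<open>cosh\<close> satisfies the same product formula.
\<close>

lemma Op_power_cheb_bound:
  assumes lip: "\<And>v w. P v w \<noteq> 0 \<Longrightarrow> \<bar>\<phi> v - \<phi> w\<bar> \<le> (1::real)"
    and "u \<in> V" "v \<in> V" "l \<ge> 0"
  shows "\<bar>(Op ^^ n) (cheb (indicator {u}) k) v\<bar>
    \<le> exp (- l * \<bar>\<phi> v - \<phi> u\<bar>) * cosh l ^ n * (2 * cosh (l * real k))"
proof (induction n arbitrary: k)
  case 0
  let ?d = "\<bar>\<phi> v - \<phi> u\<bar>"
  have pos: "0 < exp (- l * ?d) * (2 * cosh (l * real k))"
    by (simp add: cosh_real_pos)
  show ?case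
  proof (cases "?d > real k")
    case True
    then have "cheb (indicator {u}) k v = 0"
      using cheb_propagation[where \<phi> = \<phi> and u = u and f = "indicator {u}" and k = k, OF lip] by (auto simp: indicator_def split: if_splits)
    then show ?thesis using pos by simp
  next
    case False
    have "1 \<le> exp (l * real k - l * ?d)"
      using False assms(4) by (simp add: mult_left_mono)
    also have "\<dots> \<le> exp (- l * ?d) * (2 * cosh (l * real k))"
      by (simp add: cosh_field_def exp_diff exp_minus field_simps)
    finally show ?thesis using cheb_pointwise_le[OF assms(2,3), of k] by simp
  qed
next
  case (Suc n)
  let ?t = "cheb (indicator {u})" and ?c = "exp (- l * \<bar>\<phi> v - \<phi> u\<bar>) * cosh l ^ n"
  have lin: "(Op ^^ n) (\<lambda>v. (f v + g v) / 2) = (\<lambda>v. ((Op ^^ n) f v + (Op ^^ n) g v) / 2)" for f g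
  proof (induction n)
    case (Suc n)
    then show ?case
      using Op_scale[of "1/2"] Op_add by simp
  qed simp
  show ?case
  proof (cases k)
    case 0
    then have "(Op ^^ Suc n) (?t k) = (Op ^^ n) (?t (Suc 0))"
      by (simp only: funpow_Suc_right o_apply Op_cheb_0)
    then show ?thesis
      using Suc[of "Suc 0"] 0 by (simp add: mult_ac)
  next
    case (Suc j)
    have half: "\<bar>(a + b) / 2\<bar> \<le> (\<bar>a\<bar> + \<bar>b\<bar>) / 2" for a b :: real
      by (simp add: abs_triangle_ineq)
    have "(Op ^^ Suc n) (?t k) v = ((Op ^^ n) (?t (Suc (Suc j))) v + (Op ^^ n) (?t j) v) / 2"
      by (simp only: Suc funpow_Suc_right o_apply Op_cheb_Suc lin)
    then have "\<bar>(Op ^^ Suc n) (?t k) v\<bar> \<le> (\<bar>(Op ^^ n) (?t (Suc (Suc j))) v\<bar> + \<bar>(Op ^^ n) (?t j) v\<bar>) / 2"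
      by (simp only: half)
    also have "\<dots> \<le> (?c * (2 * cosh (l * real (Suc (Suc j)))) + ?c * (2 * cosh (l * real j))) / 2"
      by (intro divide_right_mono add_mono Suc.IH) auto
    also have "\<dots> = ?c * (cosh (l * real k + l) + cosh (l * real k - l))"
      by (simp add: Suc algebra_simps)
    also have "\<dots> = ?c * (2 * cosh l * cosh (l * real k))"
      by (simp add: cosh_add cosh_diff)
    finally show ?thesis by (simp add: mult_ac)
  qed
qed

text \<open>The previous bound at \<open>k = 0\<close>, optimised over the exponential parameter.\<close>

theorem Carne_Varopoulos:
  assumes lip: "\<And>v w. P v w \<noteq> 0 \<Longrightarrow> \<bar>\<phi> v - \<phi> w\<bar> \<le> (1::real)"
    and uv: "u \<in> V" "v \<in> V"
  shows "(Op ^^ n) (indicator {u}) v \<le> 2 * exp (- (\<phi> v - \<phi> u)\<^sup>2 / (2 * real n))"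
proof (cases "n = 0")
  case True
  then show ?thesis by (simp add: indicator_def)
next
  case False
  define d where "d = \<bar>\<phi> v - \<phi> u\<bar>"
  define l where "l = d / real n"
  have "\<bar>(Op ^^ n) (cheb (indicator {u}) 0) v\<bar> \<le> exp (- l * d) * cosh l ^ n * (2 * cosh (l * real 0))"
    unfolding d_def by (rule Op_power_cheb_bound[OF lip uv]) (auto simp: l_def d_def)
  then have "(Op ^^ n) (indicator {u}) v \<le> 2 * (exp (- l * d) * cosh l ^ n)"
    by simp
  also have "\<dots> \<le> 2 * (exp (- l * d) * exp (l\<^sup>2 / 2) ^ n)"
    by (intro mult_left_mono power_mono cosh_le_exp) (auto simp: cosh_real_nonneg)
  also have "exp (- l * d) * exp (l\<^sup>2 / 2) ^ n = exp (- l * d + real n * (l\<^sup>2 / 2))"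
    by (simp only: exp_add exp_of_nat_mult)
  also have "- l * d + real n * (l\<^sup>2 / 2) = - (\<phi> v - \<phi> u)\<^sup>2 / (2 * real n)"
    using False by (simp add: l_def d_def field_simps power2_eq_square)
  finally show ?thesis .
qed

end

section \<open>Continuous integer-valued functions on a subshift\<close>

definition agree :: "int \<Rightarrow> (int \<Rightarrow> 'a) \<Rightarrow> (int \<Rightarrow> 'a) \<Rightarrow> bool" where
  "agree r x y \<longleftrightarrow> (\<forall>i. \<bar>i\<bar> \<le> r \<longrightarrow> x i = y i)"

lemma compact_space_subshift:
  assumes "subshift A \<Sigma>"
  shows "compact_space (subshift_topology A \<Sigma>)"
proof -
  have "compact_space (full_shift_topology A)"
    using assms unfolding full_shift_topology_def subshift_def
    by (simp add: compact_space_product_topology compact_space_discrete_topology)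
  then show ?thesis
    using assms unfolding subshift_def subshift_topology_def
    by (intro compact_space_subtopology closedin_compact_space) simp_all
qed

lemma openin_cylinder:
  assumes "subshift A \<Sigma>" "x \<in> \<Sigma>"
  shows "openin (subshift_topology A \<Sigma>) {y \<in> \<Sigma>. agree r x y}"
proof -
  let ?U = "\<lambda>i. if \<bar>i\<bar> \<le> r then {x i} else A"
  have "openin (full_shift_topology A) (Pi\<^sub>E UNIV ?U)"
    unfolding full_shift_topology_def
  proof (rule product_topology_basis)
    show "finite {i. ?U i \<noteq> topspace (discrete_topology A)}"
      by (rule finite_subset[of _ "{-r..r}"]) auto
    show "openin (discrete_topology A) (?U i)" for i
      using subshift_imp_range[OF assms, of i] by simp
  qed
  then have "openin (subshift_topology A \<Sigma>) (\<Sigma> \<inter> Pi\<^sub>E UNIV ?U)"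
    unfolding subshift_topology_def by (rule openin_subtopology_Int2)
  moreover have "\<Sigma> \<inter> Pi\<^sub>E UNIV ?U = {y \<in> \<Sigma>. agree r x y}"
  proof (rule Set.set_eqI, rule iffI)
    fix y assume "y \<in> {y \<in> \<Sigma>. agree r x y}"
    then show "y \<in> \<Sigma> \<inter> Pi\<^sub>E UNIV ?U"
      using subshift_imp_range[OF assms(1), of y] by (simp add: agree_def PiE_iff)
  next
    fix y assume y: "y \<in> \<Sigma> \<inter> Pi\<^sub>E UNIV ?U"
    have "x i = y i" if "\<bar>i\<bar> \<le> r" for i
      using PiE_mem[of y UNIV ?U i] y that by simp
    then show "y \<in> {y \<in> \<Sigma>. agree r x y}"
      using y by (simp add: agree_def)
  qed
  ultimately show ?thesis by simp
qed

lemma cylinder_neighbourhood: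
  assumes "subshift A \<Sigma>" "openin (subshift_topology A \<Sigma>) U" "x \<in> U"
  obtains r where "{y \<in> \<Sigma>. agree r x y} \<subseteq> U"
proof -
  obtain S where S: "openin (full_shift_topology A) S" "U = S \<inter> \<Sigma>"
    using assms(2) unfolding subshift_topology_def openin_subtopology by auto
  have "x \<in> S" using S(2) assms(3) by simp
  with S(1) obtain V where V: "finite {i. V i \<noteq> A}" "x \<in> Pi\<^sub>E UNIV V" "Pi\<^sub>E UNIV V \<subseteq> S"
    using product_topology_open_contains_basis[of "\<lambda>_. discrete_topology A" UNIV S x]
    unfolding full_shift_topology_def topspace_discrete_topology by blast
  define r where "r = Max (abs ` {i. V i \<noteq> A})"
  have r: "\<bar>i\<bar> \<le> r" if "i \<in> {i. V i \<noteq> A}" for i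
    unfolding r_def using that V(1) by (intro Max_ge) simp_all
  have "y \<in> U" if "y \<in> \<Sigma>" "agree r x y" for y
  proof -
    have "y i \<in> V i" for i
      using r[of i] that V(2) subshift_imp_range[OF assms(1) that(1), of i]
        PiE_mem[of x UNIV V i]
      by (cases "V i = A") (simp_all add: agree_def)
    then have "y \<in> Pi\<^sub>E UNIV V" by (simp add: PiE_iff)
    then show ?thesis using V(3) S(2) that(1) by blast
  qed
  then show thesis using that by blast
qed

text \<open>The set of points where the value is decided by the window of radius \<open>r\<close> is open and grows
  with \<open>r\<close>; by compactness one radius serves all points.\<close>

lemma continuous_imp_local:
  assumes "subshift A \<Sigma>" and k: "continuous_map (subshift_topology A \<Sigma>) (discrete_topology UNIV) k"
  obtains r :: nat where "\<And>x y. x \<in> \<Sigma> \<Longrightarrow> y \<in> \<Sigma> \<Longrightarrow> agree (int r) x y \<Longrightarrow> k x = k y"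
proof -
  let ?X = "subshift_topology A \<Sigma>"
  have top: "topspace ?X = \<Sigma>" using assms(1) by (rule topspace_subshift_topology)
  have fibre: "openin ?X {y \<in> \<Sigma>. k y = k x}" for x
    using openin_continuous_map_preimage[OF k, of "{k x}"] by (simp add: top)
  define O' where "O' r = {x \<in> \<Sigma>. \<forall>y\<in>\<Sigma>. agree (int r) x y \<longrightarrow> k y = k x}" for r :: nat
  have open_O: "openin ?X (O' r)" for r
  proof (subst openin_subopen, intro ballI)
    fix x assume x: "x \<in> O' r"
    have "{y \<in> \<Sigma>. agree (int r) x y} \<subseteq> O' r"
    proof
      fix y assume y: "y \<in> {y \<in> \<Sigma>. agree (int r) x y}"
      have "agree (int r) x z" if "agree (int r) y z" for z
        using that y by (simp add: agree_def)
      moreover have "k y = k x" using x y by (simp add: O'_def)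
      ultimately show "y \<in> O' r" using x y by (simp add: O'_def)
    qed
    moreover have "x \<in> \<Sigma>" using x by (simp add: O'_def)
    ultimately show "\<exists>T. openin ?X T \<and> x \<in> T \<and> T \<subseteq> O' r"
      using openin_cylinder[OF assms(1), of x "int r"]
      by (intro exI[of _ "{y \<in> \<Sigma>. agree (int r) x y}"]) (simp add: agree_def)
  qed
  have mono: "O' r \<subseteq> O' s" if "r \<le> s" for r s
  proof -
    have "agree (int r) x y" if "agree (int s) x y" for x y
      using that \<open>r \<le> s\<close> by (simp add: agree_def)
    then show ?thesis by (auto simp: O'_def)
  qed
  have "topspace ?X \<subseteq> \<Union> (range O')"
  proof
    fix x assume "x \<in> topspace ?X"
    then have x: "x \<in> {y \<in> \<Sigma>. k y = k x}" by (simp add: top)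
    obtain r where "{y \<in> \<Sigma>. agree r x y} \<subseteq> {y \<in> \<Sigma>. k y = k x}"
      using cylinder_neighbourhood[OF assms(1) fibre x] by blast
    moreover have "agree r x y" if "agree (int (nat r)) x y" for y
      using that unfolding agree_def by (auto split: if_splits)
    ultimately have "x \<in> O' (nat r)"
      using x by (auto simp: O'_def)
    then show "x \<in> \<Union> (range O')" by blast
  qed
  then obtain F where F: "finite F" "F \<subseteq> range O'" "topspace ?X \<subseteq> \<Union> F"
    using compact_space_subshift[OF assms(1), unfolded compact_space_alt, rule_format, of "range O'"] open_O
    by blast
  then obtain R where R: "finite R" "F = O' ` R"
    by (metis finite_subset_image)
  obtain r where r: "\<And>s. s \<in> R \<Longrightarrow> s \<le> r"
    using R(1) by (meson finite_nat_set_iff_bounded_le)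
  have "k x = k y" if "x \<in> \<Sigma>" "y \<in> \<Sigma>" "agree (int r) x y" for x y
  proof -
    have "x \<in> O' r" using F(3) R(2) mono[OF r] that(1) top by blast
    then show ?thesis using that by (simp add: O'_def)
  qed
  then show thesis using that by blast
qed

lemma finite_determined_by_window:
  assumes "finite A" "\<And>x. x \<in> U \<Longrightarrow> range x \<subseteq> A"
    and "finite J" and "\<And>x y. x \<in> U \<Longrightarrow> y \<in> U \<Longrightarrow> (\<And>i. i \<in> J \<Longrightarrow> x i = y i) \<Longrightarrow> f x = f y"
  shows "finite (f ` U)"
proof -
  have "finite ((\<lambda>x. restrict x J) ` U)"
    by (rule finite_subset[OF _ finite_PiE[of J "\<lambda>_. A"]]) (use assms(1-3) in \<open>auto simp: subset_iff\<close>)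
  moreover have "f ` U \<subseteq> (\<lambda>w. f (SOME y. y \<in> U \<and> restrict y J = w)) ` (\<lambda>x. restrict x J) ` U"
  proof (intro subsetI, elim imageE)
    fix b x assume x: "b = f x" "x \<in> U"
    let ?P = "\<lambda>y. y \<in> U \<and> restrict y J = restrict x J"
    have "?P (SOME y. ?P y)" by (rule someI[of _ x]) (use x in auto)
    then have "f x = f (SOME y. ?P y)"
      using x by (intro assms(4)) (auto simp: restrict_def fun_eq_iff split: if_splits)
    then show "b \<in> (\<lambda>w. f (SOME y. y \<in> U \<and> restrict y J = w)) ` (\<lambda>x. restrict x J) ` U"
      using x by auto
  qed
  ultimately show ?thesis by (meson finite_imageI finite_subset)
qed

lemma continuous_imp_bounded:
  assumes "subshift A \<Sigma>" and k: "continuous_map (subshift_topology A \<Sigma>) (discrete_topology UNIV) k"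
  shows "finite (k ` \<Sigma>)"
proof -
  obtain r where r: "\<And>x y. x \<in> \<Sigma> \<Longrightarrow> y \<in> \<Sigma> \<Longrightarrow> agree (int r) x y \<Longrightarrow> k x = k y"
    using continuous_imp_local[OF assms] by blast
  show ?thesis
  proof (rule finite_determined_by_window[of A _ "{- int r..int r}"])
    show "finite A" using assms(1) by (simp add: subshift_def)
    show "range x \<subseteq> A" if "x \<in> \<Sigma>" for x using subshift_imp_range[OF assms(1) that] by auto
    show "k x = k y" if "x \<in> \<Sigma>" "y \<in> \<Sigma>" "\<And>i. i \<in> {- int r..int r} \<Longrightarrow> x i = y i" for x y
      using r[OF that(1,2)] that(3) by (simp add: agree_def abs_le_iff)
  qed simp
qed

lemma shift_pow_0: "shift_pow 0 x = x"
  by (simp add: shift_pow_def)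

lemma shift_pow_mult_fixed:
  assumes "shift_pow p x = x"
  shows "shift_pow (m * p) x = x"
proof (induction m rule: int_induct[where k = 0])
  case base
  show ?case by (simp add: shift_pow_0)
next
  case (step1 m)
  have "shift_pow ((m + 1) * p) x = shift_pow (m * p) (shift_pow p x)"
    unfolding shift_pow_shift_pow by (simp add: algebra_simps)
  then show ?case using step1 assms by simp
next
  case (step2 m)
  have "shift_pow ((m - 1) * p) x = shift_pow ((m - 1) * p) (shift_pow p x)"
    by (simp only: assms)
  also have "\<dots> = shift_pow (m * p) x"
    unfolding shift_pow_shift_pow by (simp add: algebra_simps)
  finally show ?case using step2 by simp
qed

lemma shift_periodic_eq:
  assumes "shift_pow p x = x"
  shows "x (i mod p) = x i"
proof -
  have "x (i mod p) = shift_pow (i div p * p) x (i mod p)"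
    by (simp only: shift_pow_mult_fixed[OF assms])
  also have "\<dots> = x (i mod p + i div p * p)"
    by (simp only: shift_pow_def)
  finally show ?thesis by simp
qed

text \<open>A nonzero value \<open>p\<close> of \<open>d\<close> would be taken on an open set of points fixed by the \<open>p\<close>-th power of
  the shift. There are finitely many such points in all, so each point of the set would be isolated.
  An isolated periodic orbit would allow two different displacements for the same map.\<close>

lemma displacement_fixing_all_points:
  assumes "subshift A \<Sigma>" "no_isolated_periodic_points A \<Sigma>"
    and d: "continuous_map (subshift_topology A \<Sigma>) (discrete_topology UNIV) d"
    and fixes_all: "\<And>x. x \<in> \<Sigma> \<Longrightarrow> shift_pow (d x) x = x"
    and x: "x \<in> \<Sigma>"
  shows "d x = 0"
proof (rule ccontr)
  assume "d x \<noteq> 0"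
  let ?X = "subshift_topology A \<Sigma>"
  have top: "topspace ?X = \<Sigma>" using assms(1) by (rule topspace_subshift_topology)
  define p where "p = \<bar>d x\<bar>"
  have p: "p > 0" using \<open>d x \<noteq> 0\<close> by (simp add: p_def)
  define U where "U = {y \<in> \<Sigma>. d y = d x}"
  have U: "openin ?X U"
    using openin_continuous_map_preimage[OF d, of "{d x}"] by (simp add: top U_def)
  have per: "shift_pow p y = y" if "y \<in> U" for y
  proof -
    have "shift_pow (d x) y = y" using that fixes_all[of y] by (simp add: U_def)
    then have "shift_pow (- d x) y = shift_pow (- d x) (shift_pow (d x) y)" by simp
    also have "\<dots> = y" by (simp add: shift_pow_shift_pow shift_pow_0)
    finally show ?thesis using \<open>shift_pow (d x) y = y\<close> by (simp add: p_def abs_if)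
  qed
  have "finite (id ` U)"
  proof (rule finite_determined_by_window[of A _ "{0..<p}"])
    show "id y = id z" if "y \<in> U" "z \<in> U" "\<And>i. i \<in> {0..<p} \<Longrightarrow> y i = z i" for y z
    proof -
      have "y i = z i" for i
        using shift_periodic_eq[OF per[OF that(1)], of i] shift_periodic_eq[OF per[OF that(2)], of i]
          that(3)[of "i mod p"] p by simp
      then show ?thesis by (simp add: fun_eq_iff)
    qed
    show "finite A" using assms(1) by (simp add: subshift_def)
    show "range y \<subseteq> A" if "y \<in> U" for y
      using subshift_imp_range[OF assms(1), of y] that by (auto simp: U_def)
  qed simp
  then have fin: "finite U" by simp
  have "t1_space ?X"
    unfolding subshift_topology_def full_shift_topology_def
    by (intro t1_space_subtopology) (simp add: t1_space_product_topology t1_space_closedin_finite[of "discrete_topology A"])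
  then have "closedin ?X (U - {x})"
    using fin unfolding t1_space_closedin_finite by (auto simp: top U_def)
  then have "openin ?X (U - (U - {x}))"
    using U by (rule openin_diff[rotated])
  moreover have "U - (U - {x}) = {x}" using x by (auto simp: U_def)
  ultimately have "openin ?X {x}" by simp
  moreover have "periodic_point x"
  proof -
    have "(shift ^^ nat p) x = shift_pow (int (nat p)) x"
      by (simp only: shift_pow_of_nat)
    then have "(shift ^^ nat p) x = x"
      using per[of x] x p by (simp add: U_def)
    then show ?thesis using p unfolding periodic_point_def by (intro exI[of _ "nat p"]) simp
  qed
  ultimately show False
    using assms(2) x by (auto simp: no_isolated_periodic_points_def)
qed

section \<open>Shannon entropy\<close>

text \<open>Gibbs' inequality against the measure that spreads at most half of the mass evenly over \<open>B\<close>
  and at most half evenly over the remaining support: the rare values outside \<open>B\<close> cost \<open>ln M\<close> only in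
  proportion to their probability.\<close>

lemma shannon_entropy_le_split:
  fixes p :: "'g pmf" and M N :: real
  assumes fin: "finite (set_pmf p)"
    and N: "real (card (set_pmf p \<inter> B)) \<le> N" "N \<ge> 1"
    and M: "real (card (set_pmf p)) \<le> M" "M \<ge> 1"
  shows "shannon_entropy p \<le> ln 2 + ln N + measure_pmf.prob p (- B) * ln M"
proof -
  define S where "S = set_pmf p"
  define q where "q g = (if g \<in> B then 1 / (2 * N) else 1 / (2 * M))" for g
  have qpos: "q g > 0" for g using N M by (simp add: q_def)
  have sum_p: "(\<Sum>g\<in>S. pmf p g) = 1"
    using fin by (simp add: S_def sum_pmf_eq_1)
  have "(\<Sum>g\<in>S. q g) = (\<Sum>g\<in>S \<inter> B. q g) + (\<Sum>g\<in>S - B. q g)"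
    using fin by (simp add: S_def sum.Int_Diff)
  also have "(\<Sum>g\<in>S \<inter> B. q g) = real (card (S \<inter> B)) / (2 * N)"
    by (simp add: q_def)
  also have "(\<Sum>g\<in>S - B. q g) = real (card (S - B)) / (2 * M)"
    by (simp add: q_def)
  also have "real (card (S \<inter> B)) / (2 * N) \<le> 1 / 2"
    using N by (simp add: S_def field_simps)
  also have "real (card (S - B)) / (2 * M) \<le> 1 / 2"
  proof -
    have "card (S - B) \<le> card S" using fin by (intro card_mono) (auto simp: S_def)
    then have "real (card (S - B)) \<le> M" using M(1) by (simp add: S_def)
    then show ?thesis using M(2) by (simp add: field_simps)
  qed
  finally have sum_q: "(\<Sum>g\<in>S. q g) \<le> 1" by simp
  have gibbs: "- (pmf p g * ln (pmf p g)) \<le> pmf p g * - ln (q g) + (q g - pmf p g)" if "g \<in> S" for g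
  proof -
    have pos: "pmf p g > 0" using that by (simp add: S_def pmf_positive)
    have "ln (q g / pmf p g) \<le> q g / pmf p g - 1"
      using pos qpos by (intro ln_le_minus_one) simp
    then have "pmf p g * ln (q g / pmf p g) \<le> pmf p g * (q g / pmf p g - 1)"
      using pos by (intro mult_left_mono) auto
    then have "pmf p g * (ln (q g) - ln (pmf p g)) \<le> q g - pmf p g"
      using pos qpos[of g] by (simp add: ln_div right_diff_distrib)
    then show ?thesis by (simp add: algebra_simps)
  qed
  have q_ln: "- ln (q g) = ln 2 + (if g \<in> B then ln N else ln M)" for g
    using N M by (simp add: q_def ln_div ln_mult)
  have "shannon_entropy p = (\<Sum>g\<in>S. - (pmf p g * ln (pmf p g)))"
    using shannon_entropy_finite[OF fin] by (simp add: S_def sum_negf)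
  also have "\<dots> \<le> (\<Sum>g\<in>S. pmf p g * - ln (q g) + (q g - pmf p g))"
    by (intro sum_mono gibbs)
  also have "\<dots> \<le> (\<Sum>g\<in>S. pmf p g * - ln (q g))"
    using sum_q sum_p by (simp add: sum.distrib sum_subtractf sum_negf)
  also have "\<dots> \<le> (\<Sum>g\<in>S. pmf p g * (ln 2 + ln N) + (if g \<in> S - B then pmf p g else 0) * ln M)"
    unfolding q_ln using M N by (intro sum_mono) (auto simp: algebra_simps)
  also have "\<dots> = (\<Sum>g\<in>S. pmf p g) * (ln 2 + ln N) + (\<Sum>g\<in>S. if g \<in> S - B then pmf p g else 0) * ln M"
    by (simp only: sum.distrib sum_distrib_right)
  also have "(\<Sum>g\<in>S. if g \<in> S - B then pmf p g else 0) = (\<Sum>g\<in>S - B. pmf p g)"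
    using fin by (intro sum.mono_neutral_cong_right) (auto simp: S_def)
  also have "\<dots> = measure_pmf.prob p (S - B)"
    using fin by (intro measure_measure_pmf_finite[symmetric]) (simp add: S_def)
  also have "S - B = - B \<inter> set_pmf p" by (auto simp: S_def)
  also have "measure_pmf.prob p (- B \<inter> set_pmf p) = measure_pmf.prob p (- B)"
    by (rule measure_Int_set_pmf)
  finally show ?thesis using sum_p by simp
qed

lemma shannon_entropy_nonneg:
  assumes "finite (set_pmf p)"
  shows "0 \<le> shannon_entropy p"
proof -
  have "(\<Sum>g\<in>set_pmf p. pmf p g * ln (pmf p g)) \<le> 0"
    by (intro sum_nonpos mult_nonneg_nonpos) (auto simp: pmf_le_1 pmf_positive)
  then show ?thesis using shannon_entropy_finite[OF assms] by simp
qed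

section \<open>Products of independent group elements\<close>

definition eval_word :: "('g, 'm) monoid_scheme \<Rightarrow> 'g list \<Rightarrow> 'g" where
  "eval_word G l = foldr (\<lambda>g h. g \<otimes>\<^bsub>G\<^esub> h) l \<one>\<^bsub>G\<^esub>"

lemma eval_word_simps [simp]:
  "eval_word G [] = \<one>\<^bsub>G\<^esub>" "eval_word G (s # l) = s \<otimes>\<^bsub>G\<^esub> eval_word G l"
  by (simp_all add: eval_word_def)

lemma (in monoid) eval_word_closed: "set l \<subseteq> carrier G \<Longrightarrow> eval_word G l \<in> carrier G"
  by (induction l) auto

lemma (in monoid) eval_word_snoc:
  "set l \<subseteq> carrier G \<Longrightarrow> s \<in> carrier G \<Longrightarrow> eval_word G (l @ [s]) = eval_word G l \<otimes> s"
  by (induction l) (auto simp: m_assoc eval_word_closed)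

lemma (in monoid) convolution_power_eq_map_words:
  assumes "set_pmf \<mu> \<subseteq> carrier G"
  shows "convolution_power G \<mu> n = map_pmf (eval_word G) (replicate_pmf n \<mu>)"
proof (induction n)
  case 0
  then show ?case by simp
next
  case (Suc n)
  have "replicate_pmf (Suc n) \<mu>
      = bind_pmf (replicate_pmf n \<mu>) (\<lambda>l. bind_pmf \<mu> (\<lambda>s. return_pmf (l @ [s])))"
    using replicate_pmf_distrib[of n 1 \<mu>] unfolding replicate_pmf_1 bind_map_pmf by simp
  then have "map_pmf (eval_word G) (replicate_pmf (Suc n) \<mu>)
      = map_pmf (\<lambda>(l, s). eval_word G (l @ [s])) (pair_pmf (replicate_pmf n \<mu>) \<mu>)"
    by (simp only: pair_pmf_def map_bind_pmf map_return_pmf case_prod_conv)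
  also have "\<dots> = map_pmf (\<lambda>(l, s). eval_word G l \<otimes> s) (pair_pmf (replicate_pmf n \<mu>) \<mu>)"
  proof (rule map_pmf_cong[OF refl])
    fix z assume "z \<in> set_pmf (pair_pmf (replicate_pmf n \<mu>) \<mu>)"
    then have "set (fst z) \<subseteq> carrier G" "snd z \<in> carrier G"
      using assms by (auto simp: set_replicate_pmf)
    then show "(case z of (l, s) \<Rightarrow> eval_word G (l @ [s])) = (case z of (l, s) \<Rightarrow> eval_word G l \<otimes> s)"
      by (cases z) (simp add: eval_word_snoc)
  qed
  also have "\<dots> = convolution_power G \<mu> (Suc n)"
    by (simp add: convolution_def Suc pair_map_pmf1 map_pmf_comp case_prod_unfold)
  finally show ?case by simp
qed

text \<open>A union bound over the suffixes of a random word; each suffix of length \<open>m\<close> is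
  itself a sequence of \<open>m\<close> independent letters.\<close>

lemma prob_replicate_suffix_le:
  "measure_pmf.prob (replicate_pmf n p) {l. \<exists>i. B (drop i l)}
    \<le> (\<Sum>m\<le>n. measure_pmf.prob (replicate_pmf m p) {l. B l})"
proof (induction n)
  case 0
  show ?case by (simp add: indicator_def)
next
  case (Suc n)
  let ?q = "replicate_pmf (Suc n) p" and ?E = "{l. \<exists>i. B (drop i l)}"
  have tl: "map_pmf tl ?q = replicate_pmf n p"
    by (simp add: map_bind_pmf bind_return_pmf')
  have "measure_pmf.prob ?q ?E \<le> measure_pmf.prob ?q ({l. B l} \<union> tl -` ?E)"
  proof (intro measure_pmf.finite_measure_mono subsetI)
    fix l assume "l \<in> ?E"
    then obtain i where "B (drop i l)" by blast
    then show "l \<in> {l. B l} \<union> tl -` ?E"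
      by (cases i; cases l) auto
  qed simp
  also have "\<dots> \<le> measure_pmf.prob ?q {l. B l} + measure_pmf.prob ?q (tl -` ?E)"
    by (intro measure_Un_le) auto
  also have "measure_pmf.prob ?q (tl -` ?E) = measure_pmf.prob (replicate_pmf n p) ?E"
    by (simp only: measure_map_pmf[symmetric] tl)
  finally show ?case using Suc by simp
qed

section \<open>Windows and complexity\<close>

definition window :: "nat \<Rightarrow> (int \<Rightarrow> 'a) \<Rightarrow> 'a list" where
  "window r x = map (\<lambda>j. x (int j - int r)) [0..<2 * r + 1]"

lemma window_eq_iff: "window r x = window r y \<longleftrightarrow> agree (int r) x y"
proof
  assume *: "window r x = window r y"
  have "x i = y i" if "\<bar>i\<bar> \<le> int r" for i
  proof -
    have "nat (i + int r) < 2 * r + 1" using that by auto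
    then have "window r x ! nat (i + int r) = x i" "window r y ! nat (i + int r) = y i"
      using that by (auto simp: window_def simp del: upt_Suc)
    then show ?thesis using * by simp
  qed
  then show "agree (int r) x y" by (simp add: agree_def)
next
  assume "agree (int r) x y"
  then show "window r x = window r y"
    by (auto simp: window_def agree_def simp del: upt_Suc)
qed

lemma window_in_subwords: "x \<in> \<Sigma> \<Longrightarrow> window r x \<in> subwords \<Sigma> (2 * r + 1)"
  unfolding subwords_def window_def
  by (auto intro!: bexI[of _ x] exI[of _ "- int r"] simp del: upt_Suc)

lemma windows_finite_card:
  assumes "subshift A \<Sigma>"
  shows "finite (window r ` \<Sigma>)" "card (window r ` \<Sigma>) \<le> complexity \<Sigma> (2 * r + 1)"
proof -
  have "window r ` \<Sigma> \<subseteq> subwords \<Sigma> (2 * r + 1)" using window_in_subwords by blast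
  then show "finite (window r ` \<Sigma>)" "card (window r ` \<Sigma>) \<le> complexity \<Sigma> (2 * r + 1)"
    using finite_subwords[OF assms] unfolding complexity_def
    by (auto intro: finite_subset card_mono)
qed

lemma window_representative:
  assumes "x \<in> \<Sigma>"
  shows "inv_into \<Sigma> (window r) (window r x) \<in> \<Sigma>"
    and "agree (int r) x (inv_into \<Sigma> (window r) (window r x))"
  using assms by (auto simp: inv_into_into f_inv_into_f simp flip: window_eq_iff)

lemma shift_pow_closed:
  assumes "subshift A \<Sigma>" "x \<in> \<Sigma>"
  shows "shift_pow j x \<in> \<Sigma>"
proof -
  have im: "shift ` \<Sigma> = \<Sigma>" using assms(1) by (simp add: subshift_def)
  have sh: "shift y = shift_pow 1 y" for y :: "int \<Rightarrow> 'a"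
    by (simp add: shift_def shift_pow_def)
  show ?thesis
  proof (induction j rule: int_induct[where k = 0])
    case base
    then show ?case using assms(2) by (simp add: shift_pow_0)
  next
    case (step1 j)
    then have "shift_pow 1 (shift_pow j x) \<in> \<Sigma>" using im sh by (metis imageI)
    then show ?case by (simp add: shift_pow_shift_pow add.commute)
  next
    case (step2 j)
    then obtain y where y: "y \<in> \<Sigma>" "shift_pow j x = shift_pow 1 y" using im sh by (metis imageE)
    then have "shift_pow (- 1) (shift_pow j x) = y" by (simp add: shift_pow_shift_pow shift_pow_0)
    then show ?case using y(1) by (simp add: shift_pow_shift_pow)
  qed
qed

lemma agree_shift_pow:
  assumes "agree (r + \<bar>j\<bar>) x y"
  shows "agree r (shift_pow j x) (shift_pow j y)"
  using assms unfolding agree_def shift_pow_def by auto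

lemma complexity_mono:
  assumes "subshift A \<Sigma>" "m \<le> n"
  shows "complexity \<Sigma> m \<le> complexity \<Sigma> n"
proof -
  have "subwords \<Sigma> m \<subseteq> take m ` subwords \<Sigma> n"
  proof
    fix w assume "w \<in> subwords \<Sigma> m"
    then obtain x i where w: "length w = m" "x \<in> \<Sigma>" "\<And>j. j < m \<Longrightarrow> w ! j = x (i + int j)"
      unfolding subwords_def by blast
    let ?v = "map (\<lambda>j. x (i + int j)) [0..<n]"
    have "?v \<in> subwords \<Sigma> n"
      using w(2) unfolding subwords_def by (simp, intro bexI[of _ x] exI[of _ i]) simp_all
    moreover have "take m ?v = w" using w assms(2) by (intro nth_equalityI) simp_all
    ultimately show "w \<in> take m ` subwords \<Sigma> n"
      by (intro image_eqI[of w "take m" ?v]) simp_all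
  qed
  then have "card (subwords \<Sigma> m) \<le> card (take m ` subwords \<Sigma> n)"
    using finite_subwords[OF assms(1)] by (intro card_mono) simp_all
  also have "\<dots> \<le> card (subwords \<Sigma> n)"
    by (rule card_image_le[OF finite_subwords[OF assms(1)]])
  finally show ?thesis by (simp only: complexity_def)
qed

lemma complexity_pos:
  assumes "subshift A \<Sigma>" "\<Sigma> \<noteq> {}"
  shows "complexity \<Sigma> n \<ge> 1"
proof -
  obtain x where "x \<in> \<Sigma>" using assms(2) by blast
  then have "map (\<lambda>j. x (0 + int j)) [0..<n] \<in> subwords \<Sigma> n"
    unfolding subwords_def by (simp, intro bexI[of _ x] exI[of _ 0]) simp_all
  then have "0 < card (subwords \<Sigma> n)"
    using finite_subwords[OF assms(1), of n] by (subst card_gt_0_iff) blast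
  then show ?thesis by (simp add: complexity_def)
qed

text \<open>The convergent sequence of the hypothesis is bounded, and \<open>ln n \<ge> 1\<close> for \<open>n \<ge> 3\<close>; the
  factor \<open>3\<close> in the proof brings small \<open>n\<close> into that range by monotonicity.\<close>

lemma complexity_quadratic:
  assumes "subshift A \<Sigma>"
    and "(\<lambda>n. (ln (real n) / real n)\<^sup>2 * real (complexity \<Sigma> n)) \<longlonglongrightarrow> 0"
  obtains K where "K > 0" "\<And>n. n \<ge> 1 \<Longrightarrow> real (complexity \<Sigma> n) \<le> K * (real n)\<^sup>2"
proof -
  obtain B where B: "B > 0" "\<And>n. norm ((ln (real n) / real n)\<^sup>2 * real (complexity \<Sigma> n)) \<le> B"
    using convergent_imp_Bseq[OF convergentI[OF assms(2)]]
    by (elim BseqE) (rule that, assumption, erule spec)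
  have big: "real (complexity \<Sigma> n) \<le> B * (real n)\<^sup>2" if "n \<ge> 3" for n
  proof -
    have "exp 1 \<le> real n" using exp_le that by linarith
    then have "1 \<le> ln (real n)" using that by (simp add: ln_ge_iff)
    then have "1 \<le> (ln (real n))\<^sup>2" by (simp add: one_le_power)
    then have "1 * real (complexity \<Sigma> n) \<le> (ln (real n))\<^sup>2 * real (complexity \<Sigma> n)"
      by (intro mult_right_mono) auto
    also have "\<dots> = (ln (real n) / real n)\<^sup>2 * real (complexity \<Sigma> n) * (real n)\<^sup>2"
      using that by (simp add: power_divide)
    also have "\<dots> \<le> B * (real n)\<^sup>2"
      using B(2)[of n] by (intro mult_right_mono) auto
    finally show ?thesis by simp
  qed
  have "real (complexity \<Sigma> n) \<le> 9 * B * (real n)\<^sup>2" if "n \<ge> 1" for n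
  proof -
    have "complexity \<Sigma> n \<le> complexity \<Sigma> (3 * n)" by (rule complexity_mono[OF assms(1)]) simp
    then have "real (complexity \<Sigma> n) \<le> B * (real (3 * n))\<^sup>2" using big[of "3 * n"] that by linarith
    then show ?thesis by (simp add: power_mult_distrib)
  qed
  then show thesis using B(1) that[of "9 * B"] by simp
qed

section \<open>The displacement cocycle\<close>

lemma full_group_mult_apply:
  assumes "g \<in> carrier (topological_full_group A \<Sigma>)" "h \<in> carrier (topological_full_group A \<Sigma>)"
    and "x \<in> \<Sigma>"
  shows "(g \<otimes>\<^bsub>topological_full_group A \<Sigma>\<^esub> h) x = g (h x)"
  using assms by (simp add: topological_full_group_def BijGroup_def compose_def)

lemma full_group_one_apply: "x \<in> \<Sigma> \<Longrightarrow> \<one>\<^bsub>topological_full_group A \<Sigma>\<^esub> x = x"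
  by (simp add: topological_full_group_def BijGroup_def)

text \<open>A random walk with a choice of displacement functions for its steps. One number \<open>R\<close>
  bounds both the size of the displacements and the radius of the windows that determine them.\<close>

locale displaced_walk =
  fixes A :: "'a set" and \<Sigma> :: "(int \<Rightarrow> 'a) set"
    and \<mu> :: "((int \<Rightarrow> 'a) \<Rightarrow> (int \<Rightarrow> 'a)) pmf"
    and k :: "((int \<Rightarrow> 'a) \<Rightarrow> (int \<Rightarrow> 'a)) \<Rightarrow> (int \<Rightarrow> 'a) \<Rightarrow> int" and R :: nat
  assumes subshift: "subshift A \<Sigma>"
    and supp: "set_pmf \<mu> \<subseteq> carrier (topological_full_group A \<Sigma>)"
    and finite_supp: "finite (set_pmf \<mu>)"
    and symm: "symmetric_pmf (topological_full_group A \<Sigma>) \<mu>"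
    and k_moves: "s \<in> set_pmf \<mu> \<Longrightarrow> x \<in> \<Sigma> \<Longrightarrow> s x = shift_pow (k s x) x"
    and k_inverse: "s \<in> set_pmf \<mu> \<Longrightarrow> x \<in> \<Sigma> \<Longrightarrow>
        k (inv\<^bsub>topological_full_group A \<Sigma>\<^esub> s) (s x) = - k s x"
    and k_bounded: "s \<in> set_pmf \<mu> \<Longrightarrow> x \<in> \<Sigma> \<Longrightarrow> \<bar>k s x\<bar> \<le> int R"
    and k_local: "s \<in> set_pmf \<mu> \<Longrightarrow> x \<in> \<Sigma> \<Longrightarrow> y \<in> \<Sigma> \<Longrightarrow> agree (int R) x y \<Longrightarrow> k s x = k s y"
    and R_pos: "R > 0"
begin

abbreviation G where "G \<equiv> topological_full_group A \<Sigma>"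

sublocale group G
  by (rule group_topological_full_group[OF subshift])

text \<open>The head of a word acts last, so the suffixes of a word, in order of increasing length, are the
  successive stages of the walk.\<close>

fun disp :: "((int \<Rightarrow> 'a) \<Rightarrow> (int \<Rightarrow> 'a)) list \<Rightarrow> (int \<Rightarrow> 'a) \<Rightarrow> int" where
  "disp [] x = 0"
| "disp (s # l) x = disp l x + k s (shift_pow (disp l x) x)"

lemma carrier_extensional: "g \<in> carrier G \<Longrightarrow> g \<in> extensional \<Sigma>"
  by (simp add: topological_full_group_def Bij_def)

lemma eval_word_apply:
  assumes "set l \<subseteq> set_pmf \<mu>" "x \<in> \<Sigma>"
  shows "eval_word G l x = shift_pow (disp l x) x"
  using assms(1)
proof (induction l)
  case Nil
  then show ?case using assms(2) by (simp add: full_group_one_apply shift_pow_0)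
next
  case (Cons s l)
  have cl: "s \<in> carrier G" "eval_word G l \<in> carrier G"
    using Cons.prems supp by (auto intro: eval_word_closed)
  have "eval_word G (s # l) x = s (shift_pow (disp l x) x)"
    using Cons by (simp add: full_group_mult_apply[OF cl assms(2)])
  also have "\<dots> = shift_pow (k s (shift_pow (disp l x) x)) (shift_pow (disp l x) x)"
    using Cons.prems assms(2) by (intro k_moves shift_pow_closed[OF subshift]) auto
  finally show ?case by (simp add: shift_pow_shift_pow add.commute)
qed

lemma disp_bounded:
  assumes "set l \<subseteq> set_pmf \<mu>" "x \<in> \<Sigma>"
  shows "\<bar>disp l x\<bar> \<le> int (R * length l)"
  using assms(1)
proof (induction l)
  case (Cons s l)
  have "\<bar>k s (shift_pow (disp l x) x)\<bar> \<le> int R"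
    using Cons.prems assms(2) by (intro k_bounded shift_pow_closed[OF subshift]) auto
  moreover have "\<bar>disp l x\<bar> \<le> int (R * length l)"
    using Cons by simp
  ultimately show ?case by (simp add: algebra_simps)
qed simp

text \<open>While the walk stays within distance \<open>D\<close> of its start, each of its steps reads
  coordinates within \<open>D + R\<close> only.\<close>

lemma disp_local:
  assumes "set l \<subseteq> set_pmf \<mu>" "x \<in> \<Sigma>" "y \<in> \<Sigma>"
    and "\<And>i. \<bar>disp (drop i l) x\<bar> \<le> int D" and "agree (int (D + R)) x y"
  shows "disp l x = disp l y"
  using assms(1,4)
proof (induction l)
  case (Cons s l)
  have dl: "\<bar>disp (drop i l) x\<bar> \<le> int D" for i
    using Cons.prems(2)[of "Suc i"] by simp
  have IH: "disp l x = disp l y"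
    using Cons.IH Cons.prems(1) dl by simp
  have "agree (int R) (shift_pow (disp l x) x) (shift_pow (disp l x) y)"
    using assms(5) dl[of 0] by (intro agree_shift_pow) (auto simp: agree_def)
  then have "k s (shift_pow (disp l x) x) = k s (shift_pow (disp l x) y)"
    using Cons.prems(1) assms(2,3) by (intro k_local shift_pow_closed[OF subshift]) auto
  then show ?case using IH by simp
qed simp

lemma pmf_inv:
  assumes "g \<in> carrier G"
  shows "pmf \<mu> g = pmf \<mu> (inv\<^bsub>G\<^esub> g)"
  using symm assms unfolding symmetric_pmf_def by (rule bspec)

lemma inv_supp:
  assumes "s \<in> set_pmf \<mu>"
  shows "inv\<^bsub>G\<^esub> s \<in> set_pmf \<mu>"
  using assms pmf_inv[OF subsetD[OF supp assms]] by (simp only: set_pmf_iff not_False_eq_True)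

lemma map_inv: "map_pmf (\<lambda>s. inv\<^bsub>G\<^esub> s) \<mu> = \<mu>"
proof (rule pmf_eqI)
  fix g
  have "pmf (map_pmf (\<lambda>s. inv\<^bsub>G\<^esub> s) \<mu>) g = measure_pmf.prob \<mu> (((\<lambda>s. inv\<^bsub>G\<^esub> s) -` {g}) \<inter> set_pmf \<mu>)"
    by (simp only: pmf_map measure_Int_set_pmf)
  also have "\<dots> = pmf \<mu> g"
  proof (cases "g \<in> carrier G")
    case True
    have "inv\<^bsub>G\<^esub> s = g \<longleftrightarrow> s = inv\<^bsub>G\<^esub> g" if "s \<in> set_pmf \<mu>" for s
      using inv_inv[OF subsetD[OF supp that]] inv_inv[OF True] by (rule_tac iffI) (erule subst, rule sym, assumption, simp)
    then have "((\<lambda>s. inv\<^bsub>G\<^esub> s) -` {g}) \<inter> set_pmf \<mu> = {inv\<^bsub>G\<^esub> g} \<inter> set_pmf \<mu>"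
      by blast
    then have "measure_pmf.prob \<mu> (((\<lambda>s. inv\<^bsub>G\<^esub> s) -` {g}) \<inter> set_pmf \<mu>) = pmf \<mu> (inv\<^bsub>G\<^esub> g)"
      by (simp only: measure_Int_set_pmf measure_pmf_single)
    then show ?thesis
      by (simp only: pmf_inv[OF True])
  next
    case False
    then have "((\<lambda>s. inv\<^bsub>G\<^esub> s) -` {g}) \<inter> set_pmf \<mu> = {}"
      by (auto dest!: subsetD[OF supp])
    moreover have "pmf \<mu> g = 0"
      using False subsetD[OF supp, of g] by (auto simp: set_pmf_iff)
    ultimately show ?thesis by (simp only: measure_empty)
  qed
  finally show "pmf (map_pmf (\<lambda>s. inv\<^bsub>G\<^esub> s) \<mu>) g = pmf \<mu> g" .
qed

text \<open>The transition law of the displacement of the fixed point \<open>x\<close>: position \<open>i\<close> stands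
  for the point \<open>shift_pow i x\<close> of its orbit.\<close>

definition jump :: "(int \<Rightarrow> 'a) \<Rightarrow> int \<Rightarrow> int pmf" where
  "jump x i = map_pmf (\<lambda>s. i + k s (shift_pow i x)) \<mu>"

lemma jump_reversal:
  assumes "x \<in> \<Sigma>" "s \<in> set_pmf \<mu>" "i + k s (shift_pow i x) = j"
  shows "j + k (inv\<^bsub>G\<^esub> s) (shift_pow j x) = i"
proof -
  have "s (shift_pow i x) = shift_pow j x"
    using k_moves[OF assms(2) shift_pow_closed[OF subshift assms(1)], of i] assms(3)
    by (simp add: shift_pow_shift_pow add.commute)
  then show ?thesis
    using k_inverse[OF assms(2) shift_pow_closed[OF subshift assms(1)], of i] assms(3) by simp
qed

text \<open>A step \<open>s\<close> that leads from \<open>i\<close> to \<open>j\<close> is undone by \<open>s\<^sup>-\<^sup>1\<close>, which is equally likely. On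
  a periodic orbit this needs the displacements, and not just the points, to be undone.\<close>

lemma jump_sym:
  assumes "x \<in> \<Sigma>"
  shows "pmf (jump x i) j = pmf (jump x j) i"
proof -
  let ?f = "\<lambda>i s. i + k s (shift_pow i x)"
  have "pmf (jump x j) i = measure_pmf.prob (map_pmf (\<lambda>s. inv\<^bsub>G\<^esub> s) \<mu>) (?f j -` {i})"
    by (simp only: jump_def pmf_map map_inv)
  also have "\<dots> = measure_pmf.prob \<mu> (((\<lambda>s. inv\<^bsub>G\<^esub> s) -` ?f j -` {i}) \<inter> set_pmf \<mu>)"
    by (simp only: measure_map_pmf measure_Int_set_pmf)
  also have "((\<lambda>s. inv\<^bsub>G\<^esub> s) -` ?f j -` {i}) \<inter> set_pmf \<mu> = (?f i -` {j}) \<inter> set_pmf \<mu>"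
  proof (rule Set.set_eqI, rule iffI)
    fix s assume s: "s \<in> ((\<lambda>s. inv\<^bsub>G\<^esub> s) -` ?f j -` {i}) \<inter> set_pmf \<mu>"
    then have "?f j (inv\<^bsub>G\<^esub> s) = i" and supp_s: "s \<in> set_pmf \<mu>" by simp_all
    then have "?f i (inv\<^bsub>G\<^esub> (inv\<^bsub>G\<^esub> s)) = j"
      using jump_reversal[OF assms inv_supp] by blast
    then have "?f i s = j"
      by (simp only: inv_inv[OF subsetD[OF supp supp_s]])
    then show "s \<in> (?f i -` {j}) \<inter> set_pmf \<mu>" using supp_s by simp
  next
    fix s assume s: "s \<in> (?f i -` {j}) \<inter> set_pmf \<mu>"
    then have "?f j (inv\<^bsub>G\<^esub> s) = i"
      by (intro jump_reversal[OF assms]) simp_all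
    then show "s \<in> ((\<lambda>s. inv\<^bsub>G\<^esub> s) -` ?f j -` {i}) \<inter> set_pmf \<mu>"
      using s by simp
  qed
  finally show ?thesis by (simp only: jump_def pmf_map measure_Int_set_pmf)
qed

definition position :: "(int \<Rightarrow> 'a) \<Rightarrow> nat \<Rightarrow> int pmf" where
  "position x m = map_pmf (\<lambda>l. disp l x) (replicate_pmf m \<mu>)"

lemma position_0: "position x 0 = return_pmf 0"
  by (simp add: position_def)

lemma position_Suc: "position x (Suc m) = bind_pmf (position x m) (jump x)"
proof -
  have "position x (Suc m) = bind_pmf \<mu> (\<lambda>s. bind_pmf (replicate_pmf m \<mu>) (\<lambda>l. return_pmf (disp (s # l) x)))"
    by (simp add: position_def map_bind_pmf)
  also have "\<dots> = bind_pmf (replicate_pmf m \<mu>) (\<lambda>l. bind_pmf \<mu> (\<lambda>s. return_pmf (disp (s # l) x)))"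
    by (rule bind_commute_pmf)
  also have "\<dots> = bind_pmf (position x m) (jump x)"
    by (simp add: position_def jump_def map_pmf_def bind_assoc_pmf bind_return_pmf)
  finally show ?thesis .
qed

lemma set_position:
  assumes "x \<in> \<Sigma>"
  shows "set_pmf (position x m) \<subseteq> {- int (R * m)..int (R * m)}"
proof
  fix j assume "j \<in> set_pmf (position x m)"
  then obtain l where "j = disp l x" "set l \<subseteq> set_pmf \<mu>" "length l = m"
    by (auto simp: position_def set_replicate_pmf)
  then show "j \<in> {- int (R * m)..int (R * m)}"
    using disp_bounded[of l x] assms by (auto simp: abs_le_iff)
qed

lemma set_jump:
  assumes "x \<in> \<Sigma>" "pmf (jump x i) j \<noteq> 0"
  shows "\<bar>j - i\<bar> \<le> int R"
proof -
  have "j \<in> set_pmf (jump x i)" using assms(2) by (simp add: set_pmf_iff)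
  then obtain s where "s \<in> set_pmf \<mu>" "j = i + k s (shift_pow i x)" by (auto simp: jump_def)
  then show ?thesis using k_bounded[of s "shift_pow i x"] shift_pow_closed[OF subshift assms(1)] by simp
qed

text \<open>Up to time \<open>n\<close> the chain lives on the finite interval of radius \<open>R n\<close>, where the
  Carne-Varopoulos bound applies with the coordinate \<open>i / R\<close>; the prefactor is the number of
  possible positions.\<close>

lemma position_tail:
  assumes "x \<in> \<Sigma>" "m \<le> n" "D > 0"
  shows "measure_pmf.prob (position x m) {j. \<bar>j\<bar> \<ge> int D}
    \<le> real (2 * R * n + 1) * (2 * exp (- (real D / real R)\<^sup>2 / (2 * real n)))"
proof -
  define V where "V = {- int (R * n)..int (R * n)}"
  interpret K: substochastic_kernel V "\<lambda>i j. pmf (jump x i) j"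
  proof
    show "(\<Sum>j\<in>V. pmf (jump x i) j) \<le> 1" for i
      by (subst measure_measure_pmf_finite[symmetric]) (auto simp: V_def)
  qed (auto simp: V_def jump_sym[OF assms(1)])
  have pos: "pmf (position x m) j = (K.Op ^^ m) (indicator {0}) j" if "m \<le> n" for m j
    using that
  proof (induction m arbitrary: j)
    case 0
    then show ?case by (auto simp: position_0 indicator_def)
  next
    case (Suc m)
    have "pmf (position x (Suc m)) j = (\<integral>i. pmf (jump x i) j \<partial>measure_pmf (position x m))"
      by (simp add: position_Suc pmf_bind)
    also have "\<dots> = (\<Sum>i\<in>V. pmf (jump x i) j * pmf (position x m) i)"
    proof (rule integral_measure_pmf_real)
      fix i assume "i \<in> set_pmf (position x m)"
      then have "\<bar>i\<bar> \<le> int (R * m)" using set_position[OF assms(1), of m] by (auto simp: abs_le_iff)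
      moreover have "int (R * m) \<le> int (R * n)" using Suc.prems by (simp add: mult_left_mono flip: of_nat_mult)
      ultimately show "i \<in> V" unfolding V_def by (simp add: abs_le_iff)
    qed (simp add: V_def)
    also have "\<dots> = K.Op (\<lambda>i. pmf (position x m) i) j"
      by (simp add: K.Op_def jump_sym[OF assms(1), of j])
    also have "(\<lambda>i. pmf (position x m) i) = (K.Op ^^ m) (indicator {0})"
      using Suc by auto
    finally show ?case by simp
  qed
  have le: "pmf (position x m) j \<le> 2 * exp (- (real D / real R)\<^sup>2 / (2 * real n))"
    if j: "j \<in> V" "\<bar>j\<bar> \<ge> int D" for j
    \<comment> \<open>At time zero the Gaussian bound degenerates, but the walk has not left the origin.\<close>
  proof (cases "m = 0")
    case True
    then show ?thesis using j(2) assms(3) by (simp add: position_0)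
  next
    case False
    define \<phi> where "\<phi> i = real_of_int i / real R" for i
    have "(K.Op ^^ m) (indicator {0}) j \<le> 2 * exp (- (\<phi> j - \<phi> 0)\<^sup>2 / (2 * real m))"
    proof (rule K.Carne_Varopoulos)
      fix v w assume "pmf (jump x v) w \<noteq> 0"
      then have "\<bar>w - v\<bar> \<le> int R" by (rule set_jump[OF assms(1)])
      then have "\<bar>real_of_int v - real_of_int w\<bar> \<le> real R" by linarith
      moreover have "\<phi> v - \<phi> w = (real_of_int v - real_of_int w) / real R"
        by (simp add: \<phi>_def diff_divide_distrib)
      ultimately show "\<bar>\<phi> v - \<phi> w\<bar> \<le> 1" using R_pos by simp
    qed (use j in \<open>auto simp: V_def\<close>)
    also have "\<dots> \<le> 2 * exp (- (real D / real R)\<^sup>2 / (2 * real n))"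
    proof -
      have "(real D / real R)\<^sup>2 \<le> (\<phi> j - \<phi> 0)\<^sup>2"
      proof (rule abs_le_square_iff[THEN iffD1])
        have "real D \<le> \<bar>real_of_int j\<bar>" using j(2) by linarith
        then show "\<bar>real D / real R\<bar> \<le> \<bar>\<phi> j - \<phi> 0\<bar>"
          by (simp add: \<phi>_def divide_right_mono)
      qed
      then have "(real D / real R)\<^sup>2 / (2 * real n) \<le> (\<phi> j - \<phi> 0)\<^sup>2 / (2 * real m)"
        using False assms(2) by (intro frac_le) auto
      then show ?thesis by simp
    qed
    finally show ?thesis using pos[OF assms(2)] by simp
  qed
  have "measure_pmf.prob (position x m) {j. \<bar>j\<bar> \<ge> int D}
      = measure_pmf.prob (position x m) ({j. \<bar>j\<bar> \<ge> int D} \<inter> set_pmf (position x m))"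
    by (simp only: measure_Int_set_pmf)
  also have "\<dots> \<le> measure_pmf.prob (position x m) {j \<in> V. \<bar>j\<bar> \<ge> int D}"
  proof (intro measure_pmf.finite_measure_mono subsetI)
    fix j assume j: "j \<in> {j. \<bar>j\<bar> \<ge> int D} \<inter> set_pmf (position x m)"
    then have "\<bar>j\<bar> \<le> int (R * m)" using set_position[OF assms(1), of m] by (auto simp: abs_le_iff)
    moreover have "int (R * m) \<le> int (R * n)" using assms(2) by (simp add: mult_left_mono flip: of_nat_mult)
    ultimately show "j \<in> {j \<in> V. \<bar>j\<bar> \<ge> int D}" using j unfolding V_def by (simp add: abs_le_iff)
  qed simp
  also have "\<dots> = (\<Sum>j\<in>{j \<in> V. \<bar>j\<bar> \<ge> int D}. pmf (position x m) j)"
    by (rule measure_measure_pmf_finite, rule finite_subset[of _ V]) (auto simp: V_def)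
  also have "\<dots> \<le> (\<Sum>j\<in>{j \<in> V. \<bar>j\<bar> \<ge> int D}. 2 * exp (- (real D / real R)\<^sup>2 / (2 * real n)))"
    by (intro sum_mono le) auto
  also have "\<dots> = real (card {j \<in> V. \<bar>j\<bar> \<ge> int D}) * (2 * exp (- (real D / real R)\<^sup>2 / (2 * real n)))"
    by simp
  also have "\<dots> \<le> real (2 * R * n + 1) * (2 * exp (- (real D / real R)\<^sup>2 / (2 * real n)))"
  proof (intro mult_right_mono)
    have "card {j \<in> V. \<bar>j\<bar> \<ge> int D} \<le> card V" by (rule card_mono) (auto simp: V_def)
    also have "card V = 2 * R * n + 1" by (simp add: V_def nat_add_distrib nat_mult_distrib)
    finally show "real (card {j \<in> V. \<bar>j\<bar> \<ge> int D}) \<le> real (2 * R * n + 1)" by (simp only: of_nat_le_iff)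
  qed simp
  finally show ?thesis .
qed

section \<open>Words whose walks stay confined\<close>

definition confined :: "nat \<Rightarrow> ((int \<Rightarrow> 'a) \<Rightarrow> (int \<Rightarrow> 'a)) list \<Rightarrow> bool" where
  "confined D l \<longleftrightarrow> (\<forall>x\<in>\<Sigma>. \<forall>i. \<bar>disp (drop i l) x\<bar> \<le> int D)"

text \<open>Points with the same window of radius \<open>R n + R\<close> have the same displacements up to time \<open>n\<close>.
  It suffices to control one point for each such window, of which there are only \<open>\<rho>(O(n))\<close>, at
  each of the \<open>n + 1\<close> times.\<close>

lemma prob_not_confined:
  "measure_pmf.prob (replicate_pmf n \<mu>) {l. \<not> confined D l}
    \<le> real (complexity \<Sigma> (2 * (R * n + R) + 1)) *
      (real (n + 1) * (real (2 * R * n + 1) * (2 * exp (- (real (D + 1) / real R)\<^sup>2 / (2 * real n)))))"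
proof -
  define r where "r = R * n + R"
  define X where "X = (\<lambda>w. inv_into \<Sigma> (window r) w) ` window r ` \<Sigma>"
  let ?p = "\<lambda>m. replicate_pmf m \<mu>" and ?far = "\<lambda>x l. \<not> \<bar>disp l x\<bar> \<le> int D"
  define t where "t = real (2 * R * n + 1) * (2 * exp (- (real (D + 1) / real R)\<^sup>2 / (2 * real n)))"
  have t: "t \<ge> 0" by (simp add: t_def)
  have X: "X \<subseteq> \<Sigma>" "finite X" "card X \<le> complexity \<Sigma> (2 * r + 1)"
    using window_representative(1)[of _ \<Sigma> r] windows_finite_card[OF subshift, of r]
      card_image_le[of "window r ` \<Sigma>" "inv_into \<Sigma> (window r)"]
    unfolding X_def by (auto simp del: image_image)
  have single: "measure_pmf.prob (?p n) {l. \<exists>i. ?far x (drop i l)} \<le> real (n + 1) * t" if "x \<in> X" for x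
  proof -
    have x: "x \<in> \<Sigma>" using that X(1) by blast
    have "measure_pmf.prob (?p n) {l. \<exists>i. ?far x (drop i l)}
        \<le> (\<Sum>m\<le>n. measure_pmf.prob (?p m) {l. ?far x l})"
      by (rule prob_replicate_suffix_le)
    also have "\<dots> \<le> (\<Sum>m\<le>n. t)"
    proof (rule sum_mono)
      fix m assume m: "m \<in> {..n}"
      have "{l. ?far x l} = (\<lambda>l. disp l x) -` {j. \<bar>j\<bar> \<ge> int (D + 1)}"
        by (simp add: set_eq_iff) linarith
      then have "measure_pmf.prob (?p m) {l. ?far x l}
          = measure_pmf.prob (position x m) {j. \<bar>j\<bar> \<ge> int (D + 1)}"
        by (simp only: position_def measure_map_pmf)
      also have "\<dots> \<le> t"
        unfolding t_def by (rule position_tail[OF x]) (use m in auto)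
      finally show "measure_pmf.prob (?p m) {l. ?far x l} \<le> t" .
    qed
    also have "\<dots> = real (n + 1) * t" by simp
    finally show ?thesis .
  qed
  have "measure_pmf.prob (?p n) {l. \<not> confined D l}
      = measure_pmf.prob (?p n) ({l. \<not> confined D l} \<inter> set_pmf (?p n))"
    by (simp only: measure_Int_set_pmf)
  also have "\<dots> \<le> measure_pmf.prob (?p n) (\<Union>x\<in>X. {l. \<exists>i. ?far x (drop i l)})"
  proof (intro measure_pmf.finite_measure_mono subsetI)
    fix l assume l: "l \<in> {l. \<not> confined D l} \<inter> set_pmf (?p n)"
    then obtain x i where x: "x \<in> \<Sigma>" "?far x (drop i l)"
      by (auto simp: confined_def)
    have supp_l: "set l \<subseteq> set_pmf \<mu>" "length l = n"
      using l by (auto simp: set_replicate_pmf)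
    define y where "y = inv_into \<Sigma> (window r) (window r x)"
    have y: "y \<in> \<Sigma>" "agree (int r) x y" "y \<in> X"
      using window_representative[OF x(1), of r] x(1) by (auto simp: y_def X_def)
    have "disp (drop i l) x = disp (drop i l) y"
    proof (rule disp_local[OF _ x(1) y(1), where D = "R * n"])
      show "set (drop i l) \<subseteq> set_pmf \<mu>" using supp_l set_drop_subset by fast
      show "\<bar>disp (drop j (drop i l)) x\<bar> \<le> int (R * n)" for j
      proof -
        have "\<bar>disp (drop j (drop i l)) x\<bar> \<le> int (R * length (drop j (drop i l)))"
          using supp_l set_drop_subset[of "j + i" l] by (intro disp_bounded x(1)) auto
        also have "\<dots> \<le> int (R * n)"
          using supp_l(2) by (intro of_nat_mono mult_left_mono) auto
        finally show ?thesis .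
      qed
      show "agree (int (R * n + R)) x y" using y(2) by (simp only: r_def)
    qed
    then have "?far y (drop i l)" using x(2) by simp
    then show "l \<in> (\<Union>x\<in>X. {l. \<exists>i. ?far x (drop i l)})" using y(3) by blast
  qed simp
  also have "\<dots> \<le> (\<Sum>x\<in>X. measure_pmf.prob (?p n) {l. \<exists>i. ?far x (drop i l)})"
    using X(2) by (intro measure_UNION_le) auto
  also have "\<dots> \<le> (\<Sum>x\<in>X. real (n + 1) * t)"
    by (intro sum_mono single)
  also have "\<dots> = real (card X) * (real (n + 1) * t)" by simp
  also have "\<dots> \<le> real (complexity \<Sigma> (2 * r + 1)) * (real (n + 1) * t)"
    using X(3) t by (intro mult_right_mono) auto
  finally show ?thesis by (simp only: t_def r_def)
qed

definition confined_elements :: "nat \<Rightarrow> ((int \<Rightarrow> 'a) \<Rightarrow> (int \<Rightarrow> 'a)) set" where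
  "confined_elements D = eval_word G ` {l. set l \<subseteq> set_pmf \<mu> \<and> confined D l}"

text \<open>The product of a confined word is encoded by the displacement in \<open>{-D..D}\<close> of one
  representative of each window of radius \<open>D + R\<close>.\<close>

lemma card_confined_elements:
  "finite (confined_elements D)"
  "card (confined_elements D) \<le> (2 * D + 1) ^ complexity \<Sigma> (2 * (D + R) + 1)"
proof -
  define r where "r = D + R"
  let ?W = "window r ` \<Sigma>"
  define Q where "Q = ?W \<rightarrow>\<^sub>E {- int D..int D}"
  define \<Psi> where "\<Psi> F = (\<lambda>x\<in>\<Sigma>. shift_pow (F (window r x)) x)" for F :: "'a list \<Rightarrow> int"
  have "confined_elements D \<subseteq> \<Psi> ` Q"
  proof
    fix g assume "g \<in> confined_elements D"
    then obtain l where l: "set l \<subseteq> set_pmf \<mu>" "confined D l" "g = eval_word G l"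
      by (auto simp: confined_elements_def)
    define F where "F = (\<lambda>w\<in>?W. disp l (inv_into \<Sigma> (window r) w))"
    have small: "\<bar>disp (drop i l) x\<bar> \<le> int D" if "x \<in> \<Sigma>" for i x
      using l(2) that by (simp add: confined_def)
    have "F \<in> Q"
    proof -
      have "disp l (inv_into \<Sigma> (window r) w) \<in> {- int D..int D}" if "w \<in> ?W" for w
        using small[of "inv_into \<Sigma> (window r) w" 0] inv_into_into[OF that] by (simp add: abs_le_iff)
      then show ?thesis unfolding Q_def F_def by (intro restrict_PiE_iff[THEN iffD2] ballI)
    qed
    moreover have "g = \<Psi> F"
    proof (rule extensionalityI[of _ \<Sigma>])
      show "g \<in> extensional \<Sigma>"
        using l(1,3) supp eval_word_closed by (intro carrier_extensional) auto
      show "\<Psi> F \<in> extensional \<Sigma>" by (simp add: \<Psi>_def)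
      fix x assume x: "x \<in> \<Sigma>"
      have "disp l x = disp l (inv_into \<Sigma> (window r) (window r x))"
        using window_representative[OF x, of r] l(1) x small[OF x]
        by (intro disp_local[where D = D]) (simp_all add: r_def)
      then show "g x = \<Psi> F x"
        using x l by (simp add: \<Psi>_def F_def eval_word_apply)
    qed
    ultimately show "g \<in> \<Psi> ` Q" by blast
  qed
  moreover have finQ: "finite Q"
    unfolding Q_def using windows_finite_card(1)[OF subshift] by (intro finite_PiE) auto
  ultimately show "finite (confined_elements D)"
    by (meson finite_imageI finite_subset)
  have "card (confined_elements D) \<le> card (\<Psi> ` Q)"
    using \<open>confined_elements D \<subseteq> \<Psi> ` Q\<close> finQ by (intro card_mono) auto
  also have "\<dots> \<le> card Q" using finQ by (rule card_image_le)
  also have "card Q = (2 * D + 1) ^ card ?W"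
    unfolding Q_def using windows_finite_card(1)[OF subshift]
    by (simp add: card_PiE nat_add_distrib nat_mult_distrib)
  also have "\<dots> \<le> (2 * D + 1) ^ complexity \<Sigma> (2 * (D + R) + 1)"
    using windows_finite_card(2)[OF subshift, of r] by (intro power_increasing) (auto simp: r_def)
  finally show "card (confined_elements D) \<le> (2 * D + 1) ^ complexity \<Sigma> (2 * (D + R) + 1)" .
qed

text \<open>The entropy is split at the products of confined words; the products of the other words number
  at most \<open>card (set_pmf \<mu>) ^ n\<close>.\<close>

lemma entropy_convolution_power_le:
  "shannon_entropy (convolution_power G \<mu> n)
    \<le> ln 2 + real (complexity \<Sigma> (2 * (D + R) + 1)) * ln (real (2 * D + 1)) +
      real (complexity \<Sigma> (2 * (R * n + R) + 1)) *
      (real (n + 1) * (real (2 * R * n + 1) * (2 * exp (- (real (D + 1) / real R)\<^sup>2 / (2 * real n))))) *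
      (real n * ln (real (card (set_pmf \<mu>))))"
proof -
  let ?p = "convolution_power G \<mu> n" and ?B = "confined_elements D"
  have p: "?p = map_pmf (eval_word G) (replicate_pmf n \<mu>)"
    by (rule convolution_power_eq_map_words[OF supp])
  have card_pos: "card (set_pmf \<mu>) \<ge> 1"
    using finite_supp by (simp add: Suc_le_eq card_gt_0_iff set_pmf_not_empty)
  have "shannon_entropy ?p \<le> ln 2 + ln (real ((2 * D + 1) ^ complexity \<Sigma> (2 * (D + R) + 1)))
      + measure_pmf.prob ?p (- ?B) * ln (real (card (set_pmf \<mu>) ^ n))"
  proof (rule shannon_entropy_le_split)
    show "finite (set_pmf ?p)" using finite_supp by (rule finite_set_pmf_convolution_power)
    have "card (set_pmf ?p \<inter> ?B) \<le> card ?B"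
      by (intro card_mono card_confined_elements(1)) auto
    then show "real (card (set_pmf ?p \<inter> ?B)) \<le> real ((2 * D + 1) ^ complexity \<Sigma> (2 * (D + R) + 1))"
      using card_confined_elements(2)[of D] by (simp only: of_nat_le_iff)
    show "1 \<le> real ((2 * D + 1) ^ complexity \<Sigma> (2 * (D + R) + 1))" by simp
    have lists: "{xs \<in> lists (set_pmf \<mu>). length xs = n} = {xs. set xs \<subseteq> set_pmf \<mu> \<and> length xs = n}"
      by (auto simp: lists_eq_set)
    have "card (set_pmf ?p) \<le> card {xs. set xs \<subseteq> set_pmf \<mu> \<and> length xs = n}"
      unfolding p set_map_pmf set_replicate_pmf lists
      by (rule card_image_le) (rule finite_lists_length_eq[OF finite_supp])
    also have "\<dots> = card (set_pmf \<mu>) ^ n"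
      by (rule card_lists_length_eq[OF finite_supp])
    finally show "real (card (set_pmf ?p)) \<le> real (card (set_pmf \<mu>) ^ n)"
      by (simp only: of_nat_le_iff)
    show "1 \<le> real (card (set_pmf \<mu>) ^ n)" using card_pos by simp
  qed
  also have "ln (real ((2 * D + 1) ^ complexity \<Sigma> (2 * (D + R) + 1)))
      = real (complexity \<Sigma> (2 * (D + R) + 1)) * ln (real (2 * D + 1))"
    by (simp only: of_nat_power ln_realpow)
  also have "ln (real (card (set_pmf \<mu>) ^ n)) = real n * ln (real (card (set_pmf \<mu>)))"
    by (simp only: of_nat_power ln_realpow)
  also have "measure_pmf.prob ?p (- ?B) * (real n * ln (real (card (set_pmf \<mu>))))
      \<le> measure_pmf.prob (replicate_pmf n \<mu>) {l. \<not> confined D l} * (real n * ln (real (card (set_pmf \<mu>))))"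
  proof (rule mult_right_mono)
    have "measure_pmf.prob ?p (- ?B)
        = measure_pmf.prob (replicate_pmf n \<mu>) ((eval_word G -` (- ?B)) \<inter> set_pmf (replicate_pmf n \<mu>))"
      by (simp only: p measure_map_pmf measure_Int_set_pmf)
    also have "\<dots> \<le> measure_pmf.prob (replicate_pmf n \<mu>) {l. \<not> confined D l}"
      by (intro measure_pmf.finite_measure_mono subsetI)
        (auto simp: confined_elements_def set_replicate_pmf)
    finally show "measure_pmf.prob ?p (- ?B) \<le> measure_pmf.prob (replicate_pmf n \<mu>) {l. \<not> confined D l}" .
    show "0 \<le> real n * ln (real (card (set_pmf \<mu>)))" using card_pos by simp
  qed
  also have "\<dots> \<le> real (complexity \<Sigma> (2 * (R * n + R) + 1)) *
      (real (n + 1) * (real (2 * R * n + 1) * (2 * exp (- (real (D + 1) / real R)\<^sup>2 / (2 * real n))))) *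
      (real n * ln (real (card (set_pmf \<mu>))))"
    using card_pos by (intro mult_right_mono prob_not_confined) auto
  finally show ?thesis by simp
qed

section \<open>The entropy estimate\<close>

text \<open>
  The confinement radius is chosen as \<open>D = 4 R sqrt (n ln n)\<close>, for which the Gaussian factor is
  at most \<open>n ^ (-8)\<close>. It has to beat the fifth power of \<open>n\<close>: two factors come from the
  number of windows and one each from the number of times, from the number of positions and from the
  entropy of the exceptional event.
\<close>

lemma entropy_bound:
  assumes "\<Sigma> \<noteq> {}" and K: "K > 0" "\<And>n. n \<ge> 1 \<Longrightarrow> real (complexity \<Sigma> n) \<le> K * (real n)\<^sup>2"
  shows "\<exists>C>0. \<forall>n\<ge>2. shannon_entropy (convolution_power G \<mu> n)
    \<le> C * real (complexity \<Sigma> (nat \<lceil>C * sqrt (real n * ln (real n))\<rceil>)) * ln (real n)"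
proof -
  define \<rho> where "\<rho> n = real (complexity \<Sigma> n)" for n
  define H where "H n = shannon_entropy (convolution_power G \<mu> n)" for n
  define a where "a = ln (real (card (set_pmf \<mu>)))"
  \<comment> \<open>\<open>K2\<close> bounds the contribution of the exceptional event. The three summands of \<open>C\<close> pay for the
    window length, for the factor \<open>ln (2 D + 1)\<close> in the count of tables, and for the bounded terms.\<close>
  define K2 where "K2 = 300 * K * real R ^ 3 * a"
  define C where "C = 11 * real R + (2 * ln (9 * real R) + 1) + 2 * (ln 2 + K2)"
  have R: "real R \<ge> 1" using R_pos by linarith
  have a: "a \<ge> 0"
    unfolding a_def using finite_supp by (simp add: Suc_le_eq card_gt_0_iff set_pmf_not_empty)
  have K2: "K2 \<ge> 0" using K(1) a by (simp add: K2_def)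
  have lnR: "ln (9 * real R) \<ge> 0" using R by (intro ln_ge_zero) linarith
  have C_ge: "C \<ge> 11 * real R" using K2 lnR by (simp add: C_def)
  have C: "C \<ge> 11 * real R" "C > 0" using C_ge R by linarith+
  have "H n \<le> C * \<rho> (nat \<lceil>C * sqrt (real n * ln (real n))\<rceil>) * ln (real n)" if n: "n \<ge> 2" for n
  proof -
    define L where "L = ln (real n)"
    define q where "q = sqrt (real n * L)"
    define D where "D = nat \<lfloor>4 * real R * q\<rfloor>"
    have n': "real n \<ge> 2" using n by simp
    have L: "L \<ge> 1 / 2"
    proof -
      have "ln 2 \<le> L" unfolding L_def using n' by (intro ln_mono) auto
      then show ?thesis using ln2_ge_two_thirds by simp
    qed
    \<comment> \<open>The scale \<open>q\<close> is at least one already at \<open>n = 2\<close>, which absorbs all additive constants.\<close>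
    have nL: "real n * L \<ge> 1" using mult_mono[of 2 "real n" "1/2" L] n' L by simp
    then have q1: "q \<ge> 1" by (simp add: q_def)
    have q2: "q\<^sup>2 = real n * L" using nL by (simp add: q_def)
    have "L \<le> real n" unfolding L_def using n' ln_le_minus_one[of "real n"] by simp
    then have "q \<le> real n"
      unfolding q_def using n' by (intro real_le_lsqrt) (auto simp: power2_eq_square mult_left_mono)
    have Rq: "real R * q \<ge> real R" "real R * q \<ge> 1"
      using mult_left_mono[OF q1, of "real R"] R by linarith+
    have D: "real D \<le> 4 * real R * q" "4 * real R * q \<le> real (D + 1)"
      using Rq by (simp_all add: D_def) linarith+
    have win: "real (2 * (D + R) + 1) \<le> 11 * real R * q"
    proof -
      have "real (2 * (D + R) + 1) = 2 * real D + 2 * real R + 1" by simp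
      then show ?thesis using D(1) Rq by linarith
    qed
    have size: "real (2 * D + 1) \<le> 9 * real R * real n"
    proof -
      have "real (2 * D + 1) = 2 * real D + 1" by simp
      then have "real (2 * D + 1) \<le> 9 * (real R * q)" using D(1) Rq by linarith
      also have "\<dots> \<le> 9 * (real R * real n)" using \<open>q \<le> real n\<close> by (simp add: mult_left_mono)
      finally show ?thesis by simp
    qed
    let ?\<rho> = "\<rho> (nat \<lceil>C * q\<rceil>)"
    have \<rho>1: "?\<rho> \<ge> 1" using complexity_pos[OF subshift assms(1)] by (simp add: \<rho>_def)
    have main: "\<rho> (2 * (D + R) + 1) * ln (real (2 * D + 1)) \<le> ?\<rho> * ((2 * ln (9 * real R) + 1) * L)"
    proof (rule mult_mono)
      have "11 * real R * q \<le> C * q" using C(1) q1 by (intro mult_right_mono) auto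
      then have "2 * (D + R) + 1 \<le> nat \<lceil>C * q\<rceil>" using win by linarith
      then show "\<rho> (2 * (D + R) + 1) \<le> ?\<rho>"
        unfolding \<rho>_def by (simp only: of_nat_le_iff complexity_mono[OF subshift])
      have "ln (real (2 * D + 1)) \<le> ln (9 * real R * real n)"
        using size by (intro ln_mono) auto
      also have "\<dots> = ln (9 * real R) + L"
        using R n' by (simp add: ln_mult L_def)
      also have "\<dots> \<le> ln (9 * real R) * (2 * L) + L"
        using mult_left_mono[OF _ lnR, of 1 "2 * L"] L by simp
      finally show "ln (real (2 * D + 1)) \<le> (2 * ln (9 * real R) + 1) * L"
        by (simp add: algebra_simps)
    qed (auto simp: \<rho>_def)
    have tail: "\<rho> (2 * (R * n + R) + 1) * (real (n + 1) * (real (2 * R * n + 1) *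
        (2 * exp (- (real (D + 1) / real R)\<^sup>2 / (2 * real n))))) * (real n * a) \<le> K2"
    proof -
      have "exp (- (real (D + 1) / real R)\<^sup>2 / (2 * real n)) \<le> exp (- 5 * L)"
      proof -
        have "4 * q \<le> real (D + 1) / real R" using D(2) R by (simp add: field_simps)
        then have "(4 * q)\<^sup>2 \<le> (real (D + 1) / real R)\<^sup>2" using q1 by (intro power_mono) auto
        then have "16 * (real n * L) \<le> (real (D + 1) / real R)\<^sup>2" by (simp add: power_mult_distrib q2)
        moreover have "8 * L * (2 * real n) = 16 * (real n * L)" by simp
        ultimately have "8 * L * (2 * real n) \<le> (real (D + 1) / real R)\<^sup>2" by (simp only:)
        then have "8 * L \<le> (real (D + 1) / real R)\<^sup>2 / (2 * real n)"
          using n' by (subst pos_le_divide_eq) auto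
        then show ?thesis using L by simp
      qed
      also have "exp (- 5 * L) = 1 / real n ^ 5"
      proof -
        have "exp (5 * L) = real n ^ 5"
          using exp_of_nat_mult[of 5 L] n' by (simp add: L_def)
        then show ?thesis by (simp add: exp_minus inverse_eq_divide)
      qed
      finally have e: "exp (- (real (D + 1) / real R)\<^sup>2 / (2 * real n)) \<le> 1 / real n ^ 5" .
      have Rn: "real R * real n \<ge> real R * 2" "real R * real n \<ge> 2"
        using mult_left_mono[OF n', of "real R"] R by linarith+
      have "\<rho> (2 * (R * n + R) + 1) \<le> K * (real (2 * (R * n + R) + 1))\<^sup>2"
        unfolding \<rho>_def by (rule K(2)) simp
      also have "\<dots> \<le> K * (5 * real R * real n)\<^sup>2"
      proof (intro mult_left_mono power_mono)
        have "real (2 * (R * n + R) + 1) = 2 * (real R * real n) + 2 * real R + 1" by simp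
        then show "real (2 * (R * n + R) + 1) \<le> 5 * real R * real n" using Rn by linarith
      qed (use K(1) in auto)
      finally have r: "\<rho> (2 * (R * n + R) + 1) \<le> K * (5 * real R * real n)\<^sup>2" .
      have "\<rho> (2 * (R * n + R) + 1) * (real (n + 1) * (real (2 * R * n + 1) *
          (2 * exp (- (real (D + 1) / real R)\<^sup>2 / (2 * real n))))) * (real n * a)
        \<le> (K * (5 * real R * real n)\<^sup>2) * ((2 * real n) * ((3 * real R * real n) *
          (2 * (1 / real n ^ 5)))) * (real n * a)"
      proof (intro mult_mono mult_nonneg_nonneg)
        have "real (2 * R * n + 1) = 2 * (real R * real n) + 1" by simp
        then show "real (2 * R * n + 1) \<le> 3 * real R * real n" using Rn by linarith
      qed (use r e n' K(1) a in \<open>auto simp: \<rho>_def\<close>)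
      also have "\<dots> = K2"
        using n' by (simp add: K2_def field_simps power2_eq_square power3_eq_cube power_numeral_reduce)
      finally show ?thesis .
    qed
    have "H n \<le> ln 2 + \<rho> (2 * (D + R) + 1) * ln (real (2 * D + 1)) + \<rho> (2 * (R * n + R) + 1) *
        (real (n + 1) * (real (2 * R * n + 1) * (2 * exp (- (real (D + 1) / real R)\<^sup>2 / (2 * real n))))) *
        (real n * a)"
      unfolding H_def \<rho>_def a_def by (rule entropy_convolution_power_le)
    also have "\<dots> \<le> (ln 2 + K2) + ?\<rho> * ((2 * ln (9 * real R) + 1) * L)"
      using main tail by linarith
    also have "ln 2 + K2 \<le> ?\<rho> * (2 * (ln 2 + K2) * L)"
    proof -
      have "1 * 1 \<le> ?\<rho> * (2 * L)" using \<rho>1 L by (intro mult_mono) auto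
      then have "(ln 2 + K2) * 1 \<le> (ln 2 + K2) * (?\<rho> * (2 * L))"
        using K2 by (intro mult_left_mono) auto
      then show ?thesis by (simp only: mult_1_left mult_ac)
    qed
    also have "?\<rho> * (2 * (ln 2 + K2) * L) + ?\<rho> * ((2 * ln (9 * real R) + 1) * L)
        = (C - 11 * real R) * ?\<rho> * L"
      by (simp add: C_def algebra_simps)
    also have "\<dots> \<le> C * ?\<rho> * L"
      using \<rho>1 L R by (intro mult_right_mono) auto
    finally show ?thesis by (simp add: q_def L_def)
  qed
  then show ?thesis using C(2) by (auto simp: H_def \<rho>_def)
qed

end

text \<open>With \<open>m\<close> the argument of \<open>\<rho>\<close> and \<open>\<alpha>\<close> the null sequence of the hypothesis, the bound on
  \<open>H n / n\<close> is \<open>\<alpha> m\<close> times \<open>C (m / ln m)\<^sup>2 ln n / n\<close>. The last factor is bounded, since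
  \<open>m\<^sup>2\<close> is of order \<open>n ln n\<close> and \<open>ln m\<close> of order \<open>ln n\<close>.\<close>

lemma slow_bound_imp_sublinear:
  fixes \<rho> :: "nat \<Rightarrow> real" and H :: "nat \<Rightarrow> real"
  assumes lim: "(\<lambda>n. (ln (real n) / real n)\<^sup>2 * \<rho> n) \<longlonglongrightarrow> 0"
    and \<rho>: "\<And>n. \<rho> n \<ge> 0" and C: "C > 0" and H0: "\<And>n. H n \<ge> 0"
    and H: "\<And>n. n \<ge> 2 \<Longrightarrow> H n \<le> C * \<rho> (nat \<lceil>C * sqrt (real n * ln (real n))\<rceil>) * ln (real n)"
  shows "(\<lambda>n. H n / real n) \<longlonglongrightarrow> 0"
proof -
  define y where "y n = C * sqrt (real n * ln (real n))" for n
  define m where "m n = nat \<lceil>y n\<rceil>" for n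
  define \<alpha> where "\<alpha> n = (ln (real n) / real n)\<^sup>2 * \<rho> n" for n
  \<comment> \<open>The factor \<open>2\<close> absorbs the rounding of \<open>y n\<close> to \<open>m n\<close>.\<close>
  define g where "g n = C * (2 * y n / ln (y n))\<^sup>2 * (ln (real n) / real n)" for n
  have y_top: "filterlim y at_top sequentially"
    unfolding y_def using C by real_asymp
  have m_top: "filterlim m at_top sequentially"
    unfolding filterlim_at_top
  proof
    fix Z :: nat
    have "\<forall>\<^sub>F n in sequentially. real Z \<le> y n"
      using y_top unfolding filterlim_at_top by (rule spec)
    then show "\<forall>\<^sub>F n in sequentially. Z \<le> m n"
      by (rule eventually_mono) (simp add: m_def, linarith)
  qed
  \<comment> \<open>With \<open>ln (y n)\<close> asymptotic to \<open>ln n / 2\<close>, the logarithms cancel in \<open>g\<close>.\<close>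
  have g_lim: "g \<longlonglongrightarrow> C * (16 * C\<^sup>2)"
    unfolding g_def y_def using C by real_asymp
  have "(\<lambda>n. \<alpha> (m n)) \<longlonglongrightarrow> 0"
    using filterlim_compose[OF lim m_top] by (simp add: \<alpha>_def)
  then have upper: "(\<lambda>n. \<alpha> (m n) * g n) \<longlonglongrightarrow> 0"
    using tendsto_mult[OF _ g_lim] by fastforce
  have "\<forall>\<^sub>F n in sequentially. y n \<ge> 2" using y_top by (simp add: filterlim_at_top)
  then have "\<forall>\<^sub>F n in sequentially. norm (H n / real n) \<le> \<alpha> (m n) * g n"
    using eventually_ge_at_top[of 2]
  proof eventually_elim
    case (elim n)
    have m: "y n \<le> real (m n)" "real (m n) \<le> 2 * y n"
      using elim(1) by (simp_all add: m_def) linarith+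
    have ln_y: "ln (y n) > 0" using elim by simp
    have ln_m: "ln (y n) \<le> ln (real (m n))" using m elim by (intro ln_mono) auto
    have "\<rho> (m n) = \<alpha> (m n) * (real (m n) / ln (real (m n)))\<^sup>2"
      using m elim ln_y ln_m by (simp add: \<alpha>_def power_divide)
    also have "\<dots> \<le> \<alpha> (m n) * (2 * y n / ln (y n))\<^sup>2"
      using m elim ln_y ln_m \<rho> by (intro mult_left_mono power_mono frac_le) (auto simp: \<alpha>_def)
    finally have "C * \<rho> (m n) * (ln (real n) / real n) \<le> C * (\<alpha> (m n) * (2 * y n / ln (y n))\<^sup>2) * (ln (real n) / real n)"
      using C elim by (intro mult_right_mono mult_left_mono) auto
    moreover have "H n / real n \<le> C * \<rho> (m n) * (ln (real n) / real n)"
      using divide_right_mono[OF H[OF elim(2)], of "real n"] by (simp add: m_def y_def)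
    ultimately show ?case using H0[of n] by (simp add: g_def mult_ac)
  qed
  then show ?thesis by (rule Lim_null_comparison[OF _ upper])
qed

section \<open>Entropy of random walks on the topological full group\<close>

text \<open>The empty subshift has complexity zero, so here the bound asserts that the entropy vanishes;
  the full group is trivial.\<close>

lemma entropy_empty_subshift:
  assumes "subshift A {}" "set_pmf \<mu> \<subseteq> carrier (topological_full_group A {})"
  shows "shannon_entropy (convolution_power (topological_full_group A {}) \<mu> n) = 0"
proof -
  let ?G = "topological_full_group A {}" and ?p = "convolution_power (topological_full_group A {}) \<mu> n"
  interpret group ?G by (rule group_topological_full_group[OF assms(1)])
  have "carrier ?G \<subseteq> {\<lambda>_. undefined}"
    by (auto simp: topological_full_group_def Bij_def)
  moreover have "set_pmf ?p \<subseteq> carrier ?G"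
    unfolding convolution_power_eq_map_words[OF assms(2)]
    using assms(2) by (auto simp: set_replicate_pmf intro!: eval_word_closed)
  ultimately have "set_pmf ?p \<subseteq> {\<lambda>_. undefined}" by (rule order_trans[rotated])
  then have p: "?p = return_pmf (\<lambda>_. undefined)" by (rule set_pmf_subset_singleton[THEN iffD1])
  show ?thesis unfolding p by (subst shannon_entropy_finite) simp_all
qed

lemma finite_family_locally_determined:
  fixes \<kappa> :: "'g \<Rightarrow> (int \<Rightarrow> 'a) \<Rightarrow> int"
  assumes "subshift A \<Sigma>" "finite S"
    and cont: "\<And>s. s \<in> S \<Longrightarrow> continuous_map (subshift_topology A \<Sigma>) (discrete_topology UNIV) (\<kappa> s)"
  obtains R :: nat where "R > 0"
    and "\<And>s x. s \<in> S \<Longrightarrow> x \<in> \<Sigma> \<Longrightarrow> \<bar>\<kappa> s x\<bar> \<le> int R"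
    and "\<And>s x y. s \<in> S \<Longrightarrow> x \<in> \<Sigma> \<Longrightarrow> y \<in> \<Sigma> \<Longrightarrow> agree (int R) x y \<Longrightarrow> \<kappa> s x = \<kappa> s y"
proof -
  define P where "P s R \<longleftrightarrow> (\<forall>x\<in>\<Sigma>. \<bar>\<kappa> s x\<bar> \<le> int R) \<and>
    (\<forall>x\<in>\<Sigma>. \<forall>y\<in>\<Sigma>. agree (int R) x y \<longrightarrow> \<kappa> s x = \<kappa> s y)" for s and R :: nat
  have mono: "P s R'" if "P s R" "R \<le> R'" for s R R'
  proof -
    have "agree (int R) x y" if "agree (int R') x y" for x y
      using that \<open>R \<le> R'\<close> by (simp add: agree_def)
    then show ?thesis using that by (fastforce simp: P_def)
  qed
  have "\<exists>R. P s R" if s: "s \<in> S" for s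
  proof -
    obtain r :: nat where r: "\<And>x y. x \<in> \<Sigma> \<Longrightarrow> y \<in> \<Sigma> \<Longrightarrow> agree (int r) x y \<Longrightarrow> \<kappa> s x = \<kappa> s y"
      using continuous_imp_local[OF assms(1) cont[OF s]] by blast
    define b where "b = nat (Max (abs ` \<kappa> s ` \<Sigma>))"
    have b: "\<bar>\<kappa> s x\<bar> \<le> int b" if "x \<in> \<Sigma>" for x
    proof -
      have "\<bar>\<kappa> s x\<bar> \<le> Max (abs ` \<kappa> s ` \<Sigma>)"
        using continuous_imp_bounded[OF assms(1) cont[OF s]] that by (intro Max_ge) auto
      then show ?thesis unfolding b_def by linarith
    qed
    have "\<bar>\<kappa> s x\<bar> \<le> int (max r b)" if "x \<in> \<Sigma>" for x using b[OF that] by simp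
    moreover have "\<kappa> s x = \<kappa> s y" if "x \<in> \<Sigma>" "y \<in> \<Sigma>" "agree (int (max r b)) x y" for x y
      using that by (intro r) (auto simp: agree_def)
    ultimately show ?thesis unfolding P_def by blast
  qed
  then obtain f where f: "\<And>s. s \<in> S \<Longrightarrow> P s (f s)" by metis
  have "P s (Suc (sum f S))" if "s \<in> S" for s
    using member_le_sum[of s S f] that assms(2) by (intro mono[OF f[OF that]]) simp
  then show thesis unfolding P_def by (intro that[of "Suc (sum f S)"]) blast+
qed

text \<open>The function \<open>k' (s x) + k x\<close> is continuous and displaces every point to itself, so it
  vanishes.\<close>

lemma displacement_of_inverse:
  assumes sub: "subshift A \<Sigma>" and iso: "no_isolated_periodic_points A \<Sigma>"
    and s: "s \<in> carrier (topological_full_group A \<Sigma>)"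
    and k: "continuous_map (subshift_topology A \<Sigma>) (discrete_topology UNIV) k"
      "\<And>x. x \<in> \<Sigma> \<Longrightarrow> s x = shift_pow (k x) x"
    and k': "continuous_map (subshift_topology A \<Sigma>) (discrete_topology UNIV) k'"
      "\<And>x. x \<in> \<Sigma> \<Longrightarrow> (inv\<^bsub>topological_full_group A \<Sigma>\<^esub> s) x = shift_pow (k' x) x"
    and x: "x \<in> \<Sigma>"
  shows "k' (s x) = - k x"
proof -
  let ?G = "topological_full_group A \<Sigma>" and ?X = "subshift_topology A \<Sigma>"
  interpret group ?G by (rule group_topological_full_group[OF sub])
  have s_hom: "homeomorphic_map ?X ?X s" using s by (simp add: topological_full_group_def)
  have sx: "s y \<in> \<Sigma>" if "y \<in> \<Sigma>" for y
    using k(2)[OF that] shift_pow_closed[OF sub that] by simp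
  have "k' (s x) + k x = 0"
  proof (rule displacement_fixing_all_points[OF sub iso _ _ x, where d = "\<lambda>y. k' (s y) + k y"])
    have "continuous_map ?X (discrete_topology UNIV) (k' \<circ> s)"
      by (rule continuous_map_compose[OF homeomorphic_imp_continuous_map[OF s_hom] k'(1)])
    then show "continuous_map ?X (discrete_topology UNIV) (\<lambda>y. k' (s y) + k y)"
      using continuous_map_discrete_combine[of ?X "k' \<circ> s" k "(+)"] k(1) by simp
    fix y assume y: "y \<in> \<Sigma>"
    have "shift_pow (k' (s y) + k y) y = (inv\<^bsub>?G\<^esub> s) (s y)"
      using k(2)[OF y] k'(2)[OF sx[OF y]] by (simp add: shift_pow_shift_pow)
    also have "\<dots> = (inv\<^bsub>?G\<^esub> s \<otimes>\<^bsub>?G\<^esub> s) y"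
      by (simp only: full_group_mult_apply[OF inv_closed[OF s] s y])
    also have "\<dots> = y" by (simp only: l_inv[OF s] full_group_one_apply[OF y])
    finally show "shift_pow (k' (s y) + k y) y = y" .
  qed
  then show ?thesis by simp
qed

theorem theorem1p2:
  fixes A :: "'a set" and \<Sigma> :: "(int \<Rightarrow> 'a) set"
    and \<mu> :: "((int \<Rightarrow> 'a) \<Rightarrow> (int \<Rightarrow> 'a)) pmf"
  assumes "subshift A \<Sigma>"
    and "no_isolated_periodic_points A \<Sigma>"
    and "(\<lambda>n. (ln (real n) / real n)\<^sup>2 * real (complexity \<Sigma> n)) \<longlonglongrightarrow> 0"
    and "set_pmf \<mu> \<subseteq> carrier (topological_full_group A \<Sigma>)"
    and "finite (set_pmf \<mu>)"
    and "symmetric_pmf (topological_full_group A \<Sigma>) \<mu>"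
  shows "convergent (\<lambda>n. shannon_entropy (convolution_power (topological_full_group A \<Sigma>) \<mu> n) / real n) \<and>
    random_walk_entropy (topological_full_group A \<Sigma>) \<mu> = 0 \<and>
    (\<exists>C>0. \<forall>n\<ge>2.
           shannon_entropy (convolution_power (topological_full_group A \<Sigma>) \<mu> n)
           \<le> C * real (complexity \<Sigma> (nat \<lceil>C * sqrt (real n * ln (real n))\<rceil>)) * ln (real n))"
proof -
  let ?G = "topological_full_group A \<Sigma>" and ?X = "subshift_topology A \<Sigma>"
  let ?H = "\<lambda>n. shannon_entropy (convolution_power ?G \<mu> n)"
  have bound: "\<exists>C>0. \<forall>n\<ge>2. ?H n
      \<le> C * real (complexity \<Sigma> (nat \<lceil>C * sqrt (real n * ln (real n))\<rceil>)) * ln (real n)"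
  proof (cases "\<Sigma> = {}")
    case True
    then have "?H n = 0" for n
      using entropy_empty_subshift assms(1,4) by blast
    then show ?thesis by (intro exI[of _ 1]) simp
  next
    case False
    have "\<exists>k. continuous_map ?X (discrete_topology UNIV) k \<and> (\<forall>x\<in>\<Sigma>. s x = shift_pow (k x) x)"
      if "s \<in> carrier ?G" for s
      using that by (simp add: topological_full_group_def)
    then obtain \<kappa> where \<kappa>: "\<And>s. s \<in> carrier ?G \<Longrightarrow> continuous_map ?X (discrete_topology UNIV) (\<kappa> s)"
        "\<And>s x. s \<in> carrier ?G \<Longrightarrow> x \<in> \<Sigma> \<Longrightarrow> s x = shift_pow (\<kappa> s x) x"
      by metis
    obtain R :: nat where R: "R > 0"
        "\<And>s x. s \<in> set_pmf \<mu> \<Longrightarrow> x \<in> \<Sigma> \<Longrightarrow> \<bar>\<kappa> s x\<bar> \<le> int R"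
        "\<And>s x y. s \<in> set_pmf \<mu> \<Longrightarrow> x \<in> \<Sigma> \<Longrightarrow> y \<in> \<Sigma> \<Longrightarrow> agree (int R) x y \<Longrightarrow> \<kappa> s x = \<kappa> s y"
      using finite_family_locally_determined[OF assms(1,5), of \<kappa>] \<kappa>(1) subsetD[OF assms(4)] by metis
    interpret full: group ?G by (rule group_topological_full_group[OF assms(1)])
    interpret displaced_walk A \<Sigma> \<mu> \<kappa> R
    proof
      fix s x assume s: "s \<in> set_pmf \<mu>" and x: "x \<in> \<Sigma>"
      have sG: "s \<in> carrier ?G" using s assms(4) by (rule subsetD[rotated])
      show "s x = shift_pow (\<kappa> s x) x" by (rule \<kappa>(2)[OF sG x])
      show "\<kappa> (inv\<^bsub>?G\<^esub> s) (s x) = - \<kappa> s x"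
        by (rule displacement_of_inverse[OF assms(1,2) sG \<kappa>(1)[OF sG] \<kappa>(2)[OF sG]
              \<kappa>(1)[OF full.inv_closed[OF sG]] \<kappa>(2)[OF full.inv_closed[OF sG]] x])
    qed (use assms R in \<open>simp_all\<close>)
    obtain K where "K > 0" "\<And>n. n \<ge> 1 \<Longrightarrow> real (complexity \<Sigma> n) \<le> K * (real n)\<^sup>2"
      using complexity_quadratic[OF assms(1,3)] by blast
    then show ?thesis using entropy_bound[OF False] by blast
  qed
  obtain C where C: "C > 0" "\<And>n. n \<ge> 2 \<Longrightarrow> ?H n
      \<le> C * real (complexity \<Sigma> (nat \<lceil>C * sqrt (real n * ln (real n))\<rceil>)) * ln (real n)"
    using bound by blast
  have "?H n \<ge> 0" for n
    by (rule shannon_entropy_nonneg[OF finite_set_pmf_convolution_power[OF assms(5)]])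
  then have "(\<lambda>n. ?H n / real n) \<longlonglongrightarrow> 0"
    using C by (intro slow_bound_imp_sublinear[OF assms(3)]) auto
  then show ?thesis
    using bound unfolding random_walk_entropy_def by (auto simp: limI convergentI)
qed

end
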